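(* Let $P$ be a semi-Eulerian simplicial poset of rank $n+1$. Then \[ \Phi_P(c,d)=\sum_{i=0}^{n-1}h_i(P)\,\check\Phi^n_i(c,d). \]
   Context: All posets are finite graded posets with unique minimum $\hat0$ and maximum $\hat1$. $P$ (rank $n+1$) is semi-Eulerian if every interval $[s,t]\neq[\hat0,\hat1]$ with more than one element has as many elements of odd rank as of even rank; Eulerian if additionally $P$ itself has this property. Flag $f$-vector: for $S=\{\ell_1<\dots<\ell_k\}\subseteq[n]$, $f_S(P)$ counts chains $\hat0<x_1<\dots<x_k<\hat1$ with $\mathrm{rk}(x_i)=\ell_i$. $\chi(P)=\sum_{j=1}^n(-1)^{j-1}f_{\{j\}}(P)$, $\chi(\mathbb S^{n-1})=1-(-1)^n$. $u_S=u_1\cdots u_n$ with $u_i=b$ if $i\in S$, $a$ otherwise (non-commuting $a,b$). Set $f'_S(P)=f_S(P)$ for $S\ne\{n\}$ and $f'_{\{n\}}(P)=f_{\{n\}}(P)+\chi(\mathbb S^{n-1})-\chi(P)$, $\chi'_P(a,b)=\sum_S f'_S(P)u_S$. The $cd$-index $\Phi_P(c,d)$ is the (unique) polynomial in non-commuting $c,d$ with $\Phi_P(a+b,ab+ba)=\chi'_P(a-b,b)$ (for Eulerian $P$ this is the usual $cd$-index). $P$ is simplicial if every interval $[\hat0,x]$, $x\ne\hat1$, is a Boolean algebra; $f_{i-1}(P)$ is the number of $x$ with $[\hat0,x]$ Boolean of rank $i$, and the $h$-vector is defined by $\sum_{i=0}^n f_{i-1}(P)(x-1)^{n-i}=\sum_{i=0}^n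 h_i(P)x^{n-i}$. The polynomials $\check\Phi^n_i$: let $\Lambda^n$ be the boundary complex of an $n$-simplex with facets $\sigma_0,\dots,\sigma_n$; for $0\le i\le n-1$ let $\Gamma^n_i$ be the simplicial complex generated by $\sigma_0,\dots,\sigma_i$ (an $(n-1)$-ball), and let $\Lambda^n_i$ be its semisuspension, the regular CW complex obtained from $\Gamma^n_i$ by attaching one new $(n-1)$-cell $\tau$ with $\partial\tau=\partial\Gamma^n_i$ (so $\Lambda^n_{n-1}=\Lambda^n$). For a regular CW sphere $\Lambda$, $\Phi_\Lambda$ is the $cd$-index of its face poset with $\hat0$ (empty face) and $\hat1$ adjoined, an Eulerian poset of rank $n+1$. Set $\check\Phi^n_0=\Phi_{\Lambda^n_0}$, $\check\Phi^n_i=\Phi_{\Lambda^n_i}-\Phi_{\Lambda^n_{i-1}}$ for $1\le i\le n-1$, and $\check\Phi^n_n=0$. *)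

theory Defs
  imports "HOL-Computational_Algebra.Polynomial"
begin

definition lt_on :: "('a \<Rightarrow> 'a \<Rightarrow> bool) \<Rightarrow> 'a \<Rightarrow> 'a \<Rightarrow> bool" where
  "lt_on le x y = (le x y \<and> x \<noteq> y)"

definition covers_on :: "'a set \<Rightarrow> ('a \<Rightarrow> 'a \<Rightarrow> bool) \<Rightarrow> 'a \<Rightarrow> 'a \<Rightarrow> bool" where
  "covers_on X le x y = (lt_on le x y \<and> \<not> (\<exists>z\<in>X. lt_on le x z \<and> lt_on le z y))"

definition graded_poset ::
  "'a set \<Rightarrow> ('a \<Rightarrow> 'a \<Rightarrow> bool) \<Rightarrow> ('a \<Rightarrow> nat) \<Rightarrow> 'a \<Rightarrow> 'a \<Rightarrow> bool" where
  "graded_poset X le rk z0 z1 =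
     (finite X \<and>
      (\<forall>x\<in>X. le x x) \<and>
      (\<forall>x\<in>X. \<forall>y\<in>X. le x y \<and> le y x \<longrightarrow> x = y) \<and>
      (\<forall>x\<in>X. \<forall>y\<in>X. \<forall>z\<in>X. le x y \<and> le y z \<longrightarrow> le x z) \<and>
      z0 \<in> X \<and> z1 \<in> X \<and> (\<forall>x\<in>X. le z0 x \<and> le x z1) \<and>
      rk z0 = 0 \<and>
      (\<forall>x\<in>X. \<forall>y\<in>X. covers_on X le x y \<longrightarrow> rk y = rk x + 1))"

definition interval_on :: "'a set \<Rightarrow> ('a \<Rightarrow> 'a \<Rightarrow> bool) \<Rightarrow> 'a \<Rightarrow> 'a \<Rightarrow> 'a set" where
  "interval_on X le s t = {x \<in> X. le s x \<and> le x t}"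

definition semi_eulerian ::
  "'a set \<Rightarrow> ('a \<Rightarrow> 'a \<Rightarrow> bool) \<Rightarrow> ('a \<Rightarrow> nat) \<Rightarrow> 'a \<Rightarrow> 'a \<Rightarrow> bool" where
  "semi_eulerian X le rk z0 z1 =
     (\<forall>s\<in>X. \<forall>t\<in>X. lt_on le s t \<and> (s, t) \<noteq> (z0, z1) \<longrightarrow>
        card {x \<in> interval_on X le s t. odd (rk x)} =
        card {x \<in> interval_on X le s t. even (rk x)})"

definition boolean_lower :: "'a set \<Rightarrow> ('a \<Rightarrow> 'a \<Rightarrow> bool) \<Rightarrow> 'a \<Rightarrow> 'a \<Rightarrow> bool" where
  "boolean_lower X le z0 x =
     (\<exists>(A :: nat set) f. finite A \<and> bij_betw f (interval_on X le z0 x) (Pow A) \<and>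
        (\<forall>y\<in>interval_on X le z0 x. \<forall>z\<in>interval_on X le z0 x. le y z \<longleftrightarrow> f y \<subseteq> f z))"

definition simplicial_poset ::
  "'a set \<Rightarrow> ('a \<Rightarrow> 'a \<Rightarrow> bool) \<Rightarrow> ('a \<Rightarrow> nat) \<Rightarrow> 'a \<Rightarrow> 'a \<Rightarrow> bool" where
  "simplicial_poset X le rk z0 z1 = (\<forall>x\<in>X. x \<noteq> z1 \<longrightarrow> boolean_lower X le z0 x)"

definition flag_f ::
  "'a set \<Rightarrow> ('a \<Rightarrow> 'a \<Rightarrow> bool) \<Rightarrow> ('a \<Rightarrow> nat) \<Rightarrow> 'a \<Rightarrow> 'a \<Rightarrow> nat set \<Rightarrow> nat" where
  "flag_f X le rk z0 z1 S =
     card {C. C \<subseteq> X - {z0, z1} \<and> (\<forall>x\<in>C. \<forall>y\<in>C. le x y \<or> le y x) \<and>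
              card C = card S \<and> rk ` C = S}"

definition pn :: "('a \<Rightarrow> nat) \<Rightarrow> 'a \<Rightarrow> nat" where
  "pn rk z1 = rk z1 - 1"

definition euler_chi ::
  "'a set \<Rightarrow> ('a \<Rightarrow> 'a \<Rightarrow> bool) \<Rightarrow> ('a \<Rightarrow> nat) \<Rightarrow> 'a \<Rightarrow> 'a \<Rightarrow> int" where
  "euler_chi X le rk z0 z1 =
     (\<Sum>j = 1..pn rk z1. (-1) ^ (j - 1) * int (flag_f X le rk z0 z1 {j}))"

definition chi_sphere :: "nat \<Rightarrow> int" where
  "chi_sphere n = 1 - (-1) ^ n"

definition flag_f' ::
  "'a set \<Rightarrow> ('a \<Rightarrow> 'a \<Rightarrow> bool) \<Rightarrow> ('a \<Rightarrow> nat) \<Rightarrow> 'a \<Rightarrow> 'a \<Rightarrow> nat set \<Rightarrow> int" where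
  "flag_f' X le rk z0 z1 S =
     (if S = {pn rk z1}
      then int (flag_f X le rk z0 z1 S) + chi_sphere (pn rk z1) - euler_chi X le rk z0 z1
      else int (flag_f X le rk z0 z1 S))"

text \<open>face_num X le rk z0 i = f_{i-1}(P)\<close>
definition face_num ::
  "'a set \<Rightarrow> ('a \<Rightarrow> 'a \<Rightarrow> bool) \<Rightarrow> ('a \<Rightarrow> nat) \<Rightarrow> 'a \<Rightarrow> nat \<Rightarrow> nat" where
  "face_num X le rk z0 i = card {x \<in> X. boolean_lower X le z0 x \<and> rk x = i}"

definition h_vec ::
  "'a set \<Rightarrow> ('a \<Rightarrow> 'a \<Rightarrow> bool) \<Rightarrow> ('a \<Rightarrow> nat) \<Rightarrow> 'a \<Rightarrow> 'a \<Rightarrow> nat \<Rightarrow> int" where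
  "h_vec X le rk z0 z1 k =
     coeff (\<Sum>i = 0..pn rk z1. smult (int (face_num X le rk z0 i)) ([:-1, 1:] ^ (pn rk z1 - i)))
           (pn rk z1 - k)"

type_synonym ncpoly = "bool list \<Rightarrow> int"

definition nc_one :: ncpoly where
  "nc_one = (\<lambda>v. if v = [] then 1 else 0)"

definition nc_var :: "bool \<Rightarrow> ncpoly" where
  "nc_var x = (\<lambda>v. if v = [x] then 1 else 0)"

abbreviation nc_a :: ncpoly where "nc_a \<equiv> nc_var False"
abbreviation nc_b :: ncpoly where "nc_b \<equiv> nc_var True"

definition nc_mult :: "ncpoly \<Rightarrow> ncpoly \<Rightarrow> ncpoly" where
  "nc_mult p q = (\<lambda>v. \<Sum>i = 0..length v. p (take i v) * q (drop i v))"

definition nc_eval_word :: "('x \<Rightarrow> ncpoly) \<Rightarrow> 'x list \<Rightarrow> ncpoly" where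
  "nc_eval_word \<sigma> w = foldr (\<lambda>x acc. nc_mult (\<sigma> x) acc) w nc_one"

datatype cdl = cC | cD

text \<open>a cd-polynomial is a finitely supported coefficient function on cd-words\<close>
type_synonym cdpoly = "cdl list \<Rightarrow> int"

definition cd_subst :: "cdl \<Rightarrow> ncpoly" where
  "cd_subst x = (case x of
      cC \<Rightarrow> (\<lambda>v. nc_a v + nc_b v)
    | cD \<Rightarrow> (\<lambda>v. nc_mult nc_a nc_b v + nc_mult nc_b nc_a v))"

definition cd_eval :: "cdpoly \<Rightarrow> ncpoly" where
  "cd_eval \<Phi> = (\<lambda>v. \<Sum>w \<in> {w. \<Phi> w \<noteq> 0}. \<Phi> w * nc_eval_word cd_subst w v)"

definition u_word :: "nat \<Rightarrow> nat set \<Rightarrow> bool list" where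
  "u_word n S = map (\<lambda>i. i \<in> S) [1..<n+1]"

definition sub_amb_b :: "bool \<Rightarrow> ncpoly" where
  "sub_amb_b x = (if x then nc_b else (\<lambda>v. nc_a v - nc_b v))"

definition chi'_sub ::
  "'a set \<Rightarrow> ('a \<Rightarrow> 'a \<Rightarrow> bool) \<Rightarrow> ('a \<Rightarrow> nat) \<Rightarrow> 'a \<Rightarrow> 'a \<Rightarrow> ncpoly" where
  "chi'_sub X le rk z0 z1 =
     (\<lambda>v. \<Sum>S \<in> Pow {1..pn rk z1}.
        flag_f' X le rk z0 z1 S * nc_eval_word sub_amb_b (u_word (pn rk z1) S) v)"

definition cd_index ::
  "'a set \<Rightarrow> ('a \<Rightarrow> 'a \<Rightarrow> bool) \<Rightarrow> ('a \<Rightarrow> nat) \<Rightarrow> 'a \<Rightarrow> 'a \<Rightarrow> cdpoly" where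
  "cd_index X le rk z0 z1 =
     (THE \<Phi>. finite {w. \<Phi> w \<noteq> 0} \<and> cd_eval \<Phi> = chi'_sub X le rk z0 z1)"

text \<open>Cells of the face poset: simplices (Face {} is the empty face = bottom),
  the extra (n-1)-cell tau, and the adjoined z1.\<close>
datatype cell = Face "nat set" | Tau | Top

text \<open>facets of the boundary of the n-simplex on vertex set {0..n}\<close>
definition sigma :: "nat \<Rightarrow> nat \<Rightarrow> nat set" where
  "sigma n j = {0..n} - {j}"

definition gamma_faces :: "nat \<Rightarrow> nat \<Rightarrow> nat set set" where
  "gamma_faces n i = {F. \<exists>j\<le>i. F \<subseteq> sigma n j}"

text \<open>faces of the boundary of the ball Gamma^n_i: faces of ridges lying in exactly one facet\<close>
definition bdry_faces :: "nat \<Rightarrow> nat \<Rightarrow> nat set set" where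
  "bdry_faces n i = {F. \<exists>R. F \<subseteq> R \<and> R \<subseteq> {0..n} \<and> card R = n - 1 \<and>
                           card {j. j \<le> i \<and> R \<subseteq> sigma n j} = 1}"

definition lam_carrier :: "nat \<Rightarrow> nat \<Rightarrow> cell set" where
  "lam_carrier n i = Face ` gamma_faces n i \<union> {Tau, Top}"

fun lam_le :: "nat \<Rightarrow> nat \<Rightarrow> cell \<Rightarrow> cell \<Rightarrow> bool" where
  "lam_le n i (Face F) (Face G) = (F \<subseteq> G)"
| "lam_le n i (Face F) Tau = (F \<in> bdry_faces n i)"
| "lam_le n i Tau Tau = True"
| "lam_le n i _ Top = True"
| "lam_le n i _ _ = False"

fun lam_rk :: "nat \<Rightarrow> cell \<Rightarrow> nat" where
  "lam_rk n (Face F) = card F"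
| "lam_rk n Tau = n"
| "lam_rk n Top = n + 1"

definition Phi_Lambda :: "nat \<Rightarrow> nat \<Rightarrow> cdpoly" where
  "Phi_Lambda n i = cd_index (lam_carrier n i) (lam_le n i) (lam_rk n) (Face {}) Top"

definition check_Phi :: "nat \<Rightarrow> nat \<Rightarrow> cdpoly" where
  "check_Phi n i =
     (if i = 0 then Phi_Lambda n 0
      else if i \<le> n - 1 then (\<lambda>w. Phi_Lambda n i w - Phi_Lambda n (i - 1) w)
      else (\<lambda>w. 0))"

end

theory Submission
  imports Defs
begin

text \<open>
  In a simplicial poset a flag number is a multinomial coefficient times an entry of the
  \<open>f\<close>-vector; flags through rank \<open>n\<close> need in addition the number of incidences between ranks
  \<open>l\<close> and \<open>n\<close>, which the Dehn-Sommerville relations express through the \<open>h\<close>-vector in the same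
  way for \<open>P\<close> and for the semisuspensions. Hence both \<open>\<chi>'\<^sub>P\<close> and \<open>\<chi>'\<close> of \<open>\<Lambda>\<^sup>n\<^sub>i\<close> are combinations of the same
  \<open>ab\<close>-polynomials \<open>\<Psi>\<^sub>i = E\<^sub>n\<^sub>-\<^sub>i a + (E\<^sub>n - E\<^sub>i) b\<close>, where \<open>E\<^sub>m\<close> is the descent enumerator of the
  permutations of \<open>{1..n}\<close> with last letter at most \<open>m\<close>: \<open>\<chi>'\<^sub>P\<close> is the sum of the \<open>h\<^sub>i \<Psi>\<^sub>i\<close>, and
  \<open>\<Lambda>\<^sup>n\<^sub>k\<close> gives the sum of the \<open>\<Psi>\<^sub>i\<close> with \<open>i \<le> k\<close>.

  That \<open>\<Psi>\<^sub>i\<close> is a polynomial in \<open>c\<close> and \<open>d\<close> follows by induction on the degree from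
  \<open>\<Psi>\<^sub>i - \<Psi>\<^sub>i\<^sub>+\<^sub>1 = \<Psi>'\<^sub>i c + (E'\<^sub>i - E'\<^sub>n\<^sub>-\<^sub>1\<^sub>-\<^sub>i) d\<close>, primes denoting degree one less, because the
  differences of consecutive \<open>E\<^sub>i - E\<^sub>n\<^sub>-\<^sub>i\<close> are again sums of two polynomials \<open>\<Psi>'\<close>.
\<close>

subsection \<open>Non-commutative polynomials and the image of the cd-substitution\<close>

lemma nc_mult_one_left: "nc_mult nc_one p = p"
proof
  fix v :: "bool list"
  have "nc_mult nc_one p v = (\<Sum>i\<in>{0..length v}. if i = 0 then p v else 0)"
    unfolding nc_mult_def nc_one_def by (intro sum.cong) auto
  then show "nc_mult nc_one p v = p v" by simp
qed

lemma nc_mult_one_right: "nc_mult p nc_one = p"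
proof
  fix v :: "bool list"
  have "nc_mult p nc_one v = (\<Sum>i\<in>{0..length v}. if i = length v then p v else 0)"
    unfolding nc_mult_def nc_one_def by (intro sum.cong) auto
  then show "nc_mult p nc_one v = p v" by simp
qed

lemma nc_mult_assoc: "nc_mult (nc_mult p q) r = nc_mult p (nc_mult q r)"
proof
  fix v :: "bool list"
  let ?n = "length v"
  let ?g = "\<lambda>i j. p (take j v) * q (take (i - j) (drop j v)) * r (drop i v)"
  have "nc_mult (nc_mult p q) r v = (\<Sum>i = 0..?n. \<Sum>j = 0..i. ?g i j)"
    unfolding nc_mult_def
    by (auto simp: sum_distrib_right drop_take min_def split: if_splits intro!: sum.cong)
  also have "\<dots> = (\<Sum>(i, j) \<in> (SIGMA i:{0..?n}. {0..i}). ?g i j)"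
    by (simp add: sum.Sigma)
  also have "\<dots> = (\<Sum>(j, k) \<in> (SIGMA j:{0..?n}. {0..?n - j}). ?g (j + k) j)"
    by (rule sum.reindex_bij_witness[where j = "\<lambda>(i, j). (j, i - j)" and i = "\<lambda>(j, k). (j + k, j)"]) auto
  also have "\<dots> = (\<Sum>j = 0..?n. \<Sum>k = 0..?n - j. ?g (j + k) j)"
    by (simp add: sum.Sigma)
  also have "\<dots> = nc_mult p (nc_mult q r) v"
    unfolding nc_mult_def by (auto simp: sum_distrib_left add.commute mult.assoc intro!: sum.cong)
  finally show "nc_mult (nc_mult p q) r v = nc_mult p (nc_mult q r) v" .
qed

lemma nc_mult_add_right: "nc_mult p (\<lambda>v. q v + r v) = (\<lambda>v. nc_mult p q v + nc_mult p r v)"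
  by (simp add: nc_mult_def distrib_left sum.distrib)

lemma nc_mult_diff_right: "nc_mult p (\<lambda>v. q v - r v) = (\<lambda>v. nc_mult p q v - nc_mult p r v)"
  by (simp add: nc_mult_def right_diff_distrib sum_subtractf)

text \<open>Multiplying by a letter on the right only shifts coefficients. Identities between such
  products can therefore be checked word by word by splitting off the last letter, which is the role
  of \<open>rev_cases\<close> further on.\<close>

lemma nc_mult_var_right [simp]:
  "nc_mult p (nc_var x) [] = 0"
  "nc_mult p (nc_var x) (u @ [y]) = (if x = y then p u else 0)"
proof -
  show "nc_mult p (nc_var x) [] = 0" by (simp add: nc_mult_def nc_var_def)
  have "nc_mult p (nc_var x) (u @ [y])
      = (\<Sum>i\<in>{0..length (u @ [y])}. if i = length u then (if x = y then p u else 0) else 0)"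
    unfolding nc_mult_def
  proof (rule sum.cong)
    fix i assume "i \<in> {0..length (u @ [y])}"
    then consider "i < length u" | "i = length u" | "i = Suc (length u)" by fastforce
    then show "p (take i (u @ [y])) * nc_var x (drop i (u @ [y]))
        = (if i = length u then (if x = y then p u else 0) else 0)"
      by cases (auto simp: nc_var_def)
  qed simp
  then show "nc_mult p (nc_var x) (u @ [y]) = (if x = y then p u else 0)" by simp
qed

lemma nc_mult_var_left [simp]:
  "nc_mult (nc_var x) p [] = 0"
  "nc_mult (nc_var x) p (y # u) = (if x = y then p u else 0)"
proof -
  show "nc_mult (nc_var x) p [] = 0" by (simp add: nc_mult_def nc_var_def)
  have "nc_mult (nc_var x) p (y # u)
      = (\<Sum>i\<in>{0..length (y # u)}. if i = 1 then (if x = y then p u else 0) else 0)"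
    unfolding nc_mult_def
  proof (rule sum.cong)
    fix i assume "i \<in> {0..length (y # u)}"
    then show "nc_var x (take i (y # u)) * p (drop i (y # u))
        = (if i = 1 then (if x = y then p u else 0) else 0)"
      by (cases i) (auto simp: nc_var_def split: nat.splits)
  qed simp
  also have "\<dots> = (if x = y then p u else 0)"
    by (subst sum.delta) auto
  finally show "nc_mult (nc_var x) p (y # u) = (if x = y then p u else 0)" .
qed

lemma nc_eval_word_Nil: "nc_eval_word \<sigma> [] = nc_one"
  by (simp add: nc_eval_word_def)

lemma nc_eval_word_Cons: "nc_eval_word \<sigma> (x # w) = nc_mult (\<sigma> x) (nc_eval_word \<sigma> w)"
  by (simp add: nc_eval_word_def)

lemma nc_eval_word_snoc: "nc_eval_word \<sigma> (w @ [x]) = nc_mult (nc_eval_word \<sigma> w) (\<sigma> x)"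
  by (induction w)
    (simp_all add: nc_eval_word_Nil nc_eval_word_Cons nc_mult_one_left nc_mult_one_right nc_mult_assoc)

lemma nc_mult_cC: "nc_mult p (cd_subst cC) = (\<lambda>v. nc_mult p nc_a v + nc_mult p nc_b v)"
  by (simp add: cd_subst_def nc_mult_add_right)

lemma nc_mult_cD:
  "nc_mult p (cd_subst cD)
     = (\<lambda>v. nc_mult (nc_mult p nc_a) nc_b v + nc_mult (nc_mult p nc_b) nc_a v)"
  by (simp add: cd_subst_def nc_mult_add_right nc_mult_assoc)

lemma nc_mult_cC_left: "nc_mult (cd_subst cC) p = (\<lambda>v. nc_mult nc_a p v + nc_mult nc_b p v)"
  by (simp add: cd_subst_def nc_mult_def distrib_right sum.distrib)

lemma nc_mult_cD_left:
  "nc_mult (cd_subst cD) p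
     = (\<lambda>v. nc_mult nc_a (nc_mult nc_b p) v + nc_mult nc_b (nc_mult nc_a p) v)"
  unfolding nc_mult_assoc[symmetric]
  by (simp add: cd_subst_def nc_mult_def[of "\<lambda>v. _ v + _ v"] nc_mult_def[of "nc_mult _ _" p] distrib_right sum.distrib)

section \<open>Polynomials in the image of the cd-substitution\<close>

lemma cd_eval_superset:
  assumes "finite A" "{w. \<Phi> w \<noteq> 0} \<subseteq> A"
  shows "cd_eval \<Phi> v = (\<Sum>w\<in>A. \<Phi> w * nc_eval_word cd_subst w v)"
  unfolding cd_eval_def using assms by (intro sum.mono_neutral_left) auto

text \<open>Membership of \<open>chi'_sub\<close> in this set is the existence half of the definite
  description \<open>cd_index\<close>. Finite support is demanded because \<open>cd_eval\<close>
  sums over the support, and a sum over an infinite set is 0 by convention.\<close>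

definition cd_image :: "ncpoly set" where
  "cd_image = {F. \<exists>\<Phi>. finite {w. \<Phi> w \<noteq> 0} \<and> cd_eval \<Phi> = F}"

lemma cd_imageI: "finite {w. \<Phi> w \<noteq> 0} \<Longrightarrow> cd_eval \<Phi> \<in> cd_image"
  unfolding cd_image_def by blast

lemma cd_eval_lin:
  assumes "finite {w. \<Phi> w \<noteq> 0}" "finite {w. \<Phi>' w \<noteq> 0}"
  shows "finite {w. \<Phi> w + k * \<Phi>' w \<noteq> 0}"
    and "cd_eval (\<lambda>w. \<Phi> w + k * \<Phi>' w) = (\<lambda>v. cd_eval \<Phi> v + k * cd_eval \<Phi>' v)"
proof -
  let ?A = "{w. \<Phi> w \<noteq> 0} \<union> {w. \<Phi>' w \<noteq> 0}"
  have fin: "finite ?A" using assms by simp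
  have sub: "{w. \<Phi> w + k * \<Phi>' w \<noteq> 0} \<subseteq> ?A" by auto
  show "finite {w. \<Phi> w + k * \<Phi>' w \<noteq> 0}"
    using fin sub finite_subset by blast
  have "cd_eval (\<lambda>w. \<Phi> w + k * \<Phi>' w) v = cd_eval \<Phi> v + k * cd_eval \<Phi>' v" for v
    using cd_eval_superset[OF fin sub, of v] cd_eval_superset[OF fin, of \<Phi> v]
      cd_eval_superset[OF fin, of \<Phi>' v]
    by (simp add: distrib_right sum.distrib sum_distrib_left mult.assoc)
  then show "cd_eval (\<lambda>w. \<Phi> w + k * \<Phi>' w) = (\<lambda>v. cd_eval \<Phi> v + k * cd_eval \<Phi>' v)" by blast
qed

lemma cd_eval_zero: "cd_eval (\<lambda>w. 0) = (\<lambda>v. 0)"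
  by (simp add: cd_eval_def)

lemma cd_eval_sum:
  assumes "finite I" "\<And>i. i \<in> I \<Longrightarrow> finite {w. \<Phi> i w \<noteq> 0}"
  shows "finite {w. (\<Sum>i\<in>I. k i * \<Phi> i w) \<noteq> 0} \<and>
    cd_eval (\<lambda>w. \<Sum>i\<in>I. k i * \<Phi> i w) = (\<lambda>v. \<Sum>i\<in>I. k i * cd_eval (\<Phi> i) v)"
  using assms
proof (induction I)
  case empty
  then show ?case by (simp add: cd_eval_zero)
next
  case (insert j I)
  then show ?case
    using cd_eval_lin[of "\<lambda>w. \<Sum>i\<in>I. k i * \<Phi> i w" "\<Phi> j" "k j"] by (simp add: add.commute)
qed

lemma cd_image_lin:
  assumes "F \<in> cd_image" "G \<in> cd_image"
  shows "(\<lambda>v. F v + k * G v) \<in> cd_image"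
proof -
  obtain \<Phi> \<Phi>' where \<Phi>: "finite {w. \<Phi> w \<noteq> 0}" "cd_eval \<Phi> = F"
    and \<Phi>': "finite {w. \<Phi>' w \<noteq> 0}" "cd_eval \<Phi>' = G"
    using assms unfolding cd_image_def by blast
  show ?thesis
    using cd_imageI[OF cd_eval_lin(1)[OF \<Phi>(1) \<Phi>'(1), of k]]
    unfolding cd_eval_lin(2)[OF \<Phi>(1) \<Phi>'(1)] \<Phi>(2) \<Phi>'(2) .
qed

lemma cd_image_zero: "(\<lambda>v. 0) \<in> cd_image"
  using cd_imageI[of "\<lambda>w. 0"] by (simp add: cd_eval_zero)

lemma cd_image_add: "F \<in> cd_image \<Longrightarrow> G \<in> cd_image \<Longrightarrow> (\<lambda>v. F v + G v) \<in> cd_image"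
  using cd_image_lin[of F G 1] by simp

lemma cd_image_sum:
  "(\<And>i. i \<in> I \<Longrightarrow> F i \<in> cd_image) \<Longrightarrow> (\<lambda>v. \<Sum>i\<in>I. k i * F i v) \<in> cd_image"
proof (induction I rule: infinite_finite_induct)
  case (insert j I)
  have "(\<lambda>v. (\<Sum>i\<in>I. k i * F i v) + k j * F j v) \<in> cd_image"
    using insert by (intro cd_image_lin) auto
  then show ?case unfolding sum.insert[OF insert.hyps] by (simp only: add.commute)
next
  case (infinite I)
  then show ?case unfolding sum.infinite[OF infinite.hyps] by (intro cd_image_zero)
next
  case empty
  show ?case unfolding sum.empty by (rule cd_image_zero)
qed

lemma nc_eval_word_in_cd_image: "nc_eval_word cd_subst w \<in> cd_image"
proof -
  have "finite {u. (if u = w then 1 else 0 :: int) \<noteq> 0}" by simp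
  moreover have "cd_eval (\<lambda>u. if u = w then 1 else 0) = nc_eval_word cd_subst w"
    by (rule ext) (simp add: cd_eval_def)
  ultimately show ?thesis using cd_imageI[of "\<lambda>u. if u = w then 1 else 0"] by simp
qed

text \<open>Closure under right multiplication by \<open>c\<close> and \<open>d\<close> is what
  turns the recursion \<open>check_poly_rec\<close> into a proof of membership.\<close>

lemma cd_image_snoc:
  assumes "F \<in> cd_image"
  shows "nc_mult F (cd_subst x) \<in> cd_image"
proof -
  obtain \<Phi> where \<Phi>: "finite {w. \<Phi> w \<noteq> 0}" "cd_eval \<Phi> = F"
    using assms unfolding cd_image_def by blast
  have "nc_mult F (cd_subst x) v
      = (\<Sum>w\<in>{w. \<Phi> w \<noteq> 0}. \<Phi> w * nc_eval_word cd_subst (w @ [x]) v)" for v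
    unfolding \<Phi>(2)[symmetric] cd_eval_def nc_eval_word_snoc nc_mult_def sum_distrib_right
      sum_distrib_left mult.assoc by (rule sum.swap)
  then have "nc_mult F (cd_subst x)
      = (\<lambda>v. \<Sum>w\<in>{w. \<Phi> w \<noteq> 0}. \<Phi> w * nc_eval_word cd_subst (w @ [x]) v)" by blast
  moreover have "\<dots> \<in> cd_image"
    by (rule cd_image_sum[where F = "\<lambda>w. nc_eval_word cd_subst (w @ [x])"])
      (rule nc_eval_word_in_cd_image)
  ultimately show ?thesis by simp
qed

section \<open>Uniqueness of the cd-index\<close>

lemma cd_eval_first_letter:
  assumes "finite {w. \<Phi> w \<noteq> 0}"
  shows "cd_eval \<Phi> v = \<Phi> [] * nc_one v + nc_mult (cd_subst cC) (cd_eval (\<lambda>w. \<Phi> (cC # w))) v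
    + nc_mult (cd_subst cD) (cd_eval (\<lambda>w. \<Phi> (cD # w))) v"
proof -
  let ?A = "\<lambda>x. {w. \<Phi> (x # w) \<noteq> 0}"
  have fin: "finite (?A x)" for x
    using finite_vimageI[OF assms, of "(#) x"] by (simp add: vimage_def)
  have sub: "{w. \<Phi> w \<noteq> 0} \<subseteq> insert [] ((#) cC ` ?A cC \<union> (#) cD ` ?A cD)"
  proof
    fix w assume "w \<in> {w. \<Phi> w \<noteq> 0}"
    then show "w \<in> insert [] ((#) cC ` ?A cC \<union> (#) cD ` ?A cD)"
    proof (cases w)
      case (Cons x u)
      then show ?thesis using \<open>w \<in> _\<close> by (cases x) simp_all
    qed simp
  qed
  have letter: "(\<Sum>w\<in>(#) x ` ?A x. \<Phi> w * nc_eval_word cd_subst w v)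
      = nc_mult (cd_subst x) (cd_eval (\<lambda>w. \<Phi> (x # w))) v" for x
  proof -
    have "(\<Sum>w\<in>(#) x ` ?A x. \<Phi> w * nc_eval_word cd_subst w v)
        = (\<Sum>w\<in>?A x. \<Phi> (x # w) * nc_mult (cd_subst x) (nc_eval_word cd_subst w) v)"
      by (subst sum.reindex) (simp_all add: nc_eval_word_Cons)
    also have "\<dots> = nc_mult (cd_subst x) (cd_eval (\<lambda>w. \<Phi> (x # w))) v"
      unfolding nc_mult_def cd_eval_def sum_distrib_left mult.left_commute[of "\<Phi> _"]
      by (rule sum.swap)
    finally show ?thesis .
  qed
  have "cd_eval \<Phi> v = (\<Sum>w\<in>insert [] ((#) cC ` ?A cC \<union> (#) cD ` ?A cD). \<Phi> w * nc_eval_word cd_subst w v)"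
    using fin sub by (intro cd_eval_superset) auto
  also have "\<dots> = \<Phi> [] * nc_one v + ((\<Sum>w\<in>(#) cC ` ?A cC. \<Phi> w * nc_eval_word cd_subst w v)
     + (\<Sum>w\<in>(#) cD ` ?A cD. \<Phi> w * nc_eval_word cd_subst w v))"
  proof -
    have "(#) cC ` ?A cC \<inter> (#) cD ` ?A cD = {}" by blast
    moreover have "[] \<notin> (#) cC ` ?A cC \<union> (#) cD ` ?A cD" by blast
    ultimately show ?thesis
      using fin by (simp add: sum.union_disjoint nc_eval_word_Nil)
  qed
  finally show ?thesis by (simp add: letter)
qed

text \<open>Write the polynomial as a constant plus \<open>c F + d G\<close>. Its parts beginning
  with \<open>a\<close> and with \<open>b\<close> give \<open>F + b G = 0\<close> and
  \<open>F + a G = 0\<close>, hence \<open>G = 0\<close> and \<open>F = 0\<close>, and the induction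
  continues with the tails of the cd-words.\<close>

lemma cd_eval_eq_zero:
  assumes "finite {w. \<Phi> w \<noteq> 0}" "cd_eval \<Phi> = (\<lambda>v. 0)"
  shows "\<Phi> w = 0"
  using assms
proof (induction w arbitrary: \<Phi>)
  case Nil
  then show ?case
    using cd_eval_first_letter[of \<Phi> "[]"]
    by (simp add: nc_mult_cC_left nc_mult_cD_left nc_one_def)
next
  case (Cons x w)
  let ?F = "\<lambda>x. cd_eval (\<lambda>w. \<Phi> (x # w))"
  have fin: "finite {w. \<Phi> (x # w) \<noteq> 0}" for x
    using finite_vimageI[OF Cons.prems(1), of "(#) x"] by (simp add: vimage_def)
  have eq: "\<Phi> [] * nc_one v + nc_mult (cd_subst cC) (?F cC) v + nc_mult (cd_subst cD) (?F cD) v = 0" for v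
    using cd_eval_first_letter[OF Cons.prems(1)] Cons.prems(2) by metis
  have a: "?F cC v + nc_mult nc_b (?F cD) v = 0" for v
    using eq[of "False # v"] by (simp add: nc_mult_cC_left nc_mult_cD_left nc_one_def)
  have b: "?F cC v + nc_mult nc_a (?F cD) v = 0" for v
    using eq[of "True # v"] by (simp add: nc_mult_cC_left nc_mult_cD_left nc_one_def)
  \<comment> \<open>On a word that begins with \<open>b\<close> the product \<open>a G\<close>
    vanishes while \<open>b G\<close> has the coefficient of \<open>G\<close> at the remaining word,
    so comparing the two equations isolates \<open>G\<close>.\<close>
  have D: "?F cD v = 0" for v
    using a[of "True # v"] b[of "True # v"] by simp
  have C: "?F cC v = 0" for v
    using a[of v] D by (simp add: nc_mult_def)
  have "?F x = (\<lambda>v. 0)" using C D by (cases x) auto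
  then show ?case by (rule Cons.IH[OF fin])
qed

lemma cd_eval_inject:
  assumes "finite {w. \<Phi> w \<noteq> 0}" "finite {w. \<Phi>' w \<noteq> 0}" "cd_eval \<Phi> = cd_eval \<Phi>'"
  shows "\<Phi> = \<Phi>'"
proof
  fix w
  have "cd_eval (\<lambda>w. \<Phi> w + (-1) * \<Phi>' w) = (\<lambda>v. 0)"
    unfolding cd_eval_lin(2)[OF assms(1,2)] assms(3) by simp
  from cd_eval_eq_zero[OF cd_eval_lin(1)[OF assms(1,2)] this, of w]
  show "\<Phi> w = \<Phi>' w" by linarith
qed

lemma cd_index_eqI:
  assumes "finite {w. \<Phi> w \<noteq> 0}" "cd_eval \<Phi> = chi'_sub X le rk z0 z1"
  shows "cd_index X le rk z0 z1 = \<Phi>"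
  unfolding cd_index_def
proof (rule the_equality)
  fix \<Phi>'
  assume "finite {w. \<Phi>' w \<noteq> 0} \<and> cd_eval \<Phi>' = chi'_sub X le rk z0 z1"
  then show "\<Phi>' = \<Phi>"
    using cd_eval_inject[of \<Phi>' \<Phi>] assms by simp
qed (simp add: assms)

lemma cd_index_in_cd_image:
  assumes "chi'_sub X le rk z0 z1 \<in> cd_image"
  shows "finite {w. cd_index X le rk z0 z1 w \<noteq> 0}"
    and "cd_eval (cd_index X le rk z0 z1) = chi'_sub X le rk z0 z1"
proof -
  obtain \<Phi> where \<Phi>: "finite {w. \<Phi> w \<noteq> 0}" "cd_eval \<Phi> = chi'_sub X le rk z0 z1"
    using assms unfolding cd_image_def by blast
  show "finite {w. cd_index X le rk z0 z1 w \<noteq> 0}"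
    and "cd_eval (cd_index X le rk z0 z1) = chi'_sub X le rk z0 z1"
    unfolding cd_index_eqI[OF \<Phi>] using \<Phi> by simp_all
qed

subsection \<open>The ab-polynomials of the simplicial shelling components\<close>

text \<open>The expression in \<open>chi'_sub\<close> for an arbitrary function \<open>g\<close> in
  place of the flag numbers. This makes it linear in \<open>g\<close> and open to recursion on the
  degree.\<close>

definition flag_poly :: "nat \<Rightarrow> (nat set \<Rightarrow> int) \<Rightarrow> ncpoly" where
  "flag_poly n g = (\<lambda>v. \<Sum>S\<in>Pow {1..n}. g S * nc_eval_word sub_amb_b (u_word n S) v)"

lemma flag_poly_0: "flag_poly 0 g v = g {} * nc_one v"
  by (simp add: flag_poly_def u_word_def nc_eval_word_Nil)

lemma u_word_Suc: "u_word (Suc n) S = u_word n S @ [Suc n \<in> S]"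
  by (simp add: u_word_def)

lemma u_word_insert: "u_word n (insert (Suc n) S) = u_word n S"
  by (auto simp: u_word_def)

text \<open>A set without \<open>Suc n\<close> contributes the last letter \<open>a - b\<close> and
  a set with it contributes \<open>b\<close>. Collecting the coefficients of \<open>a\<close> and
  \<open>b\<close> gives the value without the top rank and a difference of values.\<close>

lemma flag_poly_Suc:
  "flag_poly (Suc n) g v = nc_mult (flag_poly n g) nc_a v
     + nc_mult (\<lambda>u. flag_poly n (\<lambda>T. g (insert (Suc n) T)) u - flag_poly n g u) nc_b v"
proof -
  let ?h = "\<lambda>S. nc_eval_word sub_amb_b (u_word n S)"
  have Pow: "Pow {1..Suc n} = Pow {1..n} \<union> insert (Suc n) ` Pow {1..n}"
    by (simp add: atLeastAtMostSuc_conv Pow_insert)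
  have inj: "inj_on (insert (Suc n)) (Pow {1..n})"
    by (rule inj_onI) (metis Diff_insert_absorb Pow_iff atLeastAtMost_iff not_less_eq_eq order_refl subsetD)
  have "flag_poly (Suc n) g v
      = (\<Sum>S\<in>Pow {1..n}. g S * nc_eval_word sub_amb_b (u_word (Suc n) S) v)
      + (\<Sum>S\<in>insert (Suc n) ` Pow {1..n}. g S * nc_eval_word sub_amb_b (u_word (Suc n) S) v)"
    unfolding flag_poly_def Pow by (rule sum.union_disjoint) fastforce+
  also have "(\<Sum>S\<in>Pow {1..n}. g S * nc_eval_word sub_amb_b (u_word (Suc n) S) v)
      = (\<Sum>S\<in>Pow {1..n}. g S * nc_mult (?h S) (\<lambda>v. nc_a v - nc_b v) v)"
  proof (rule sum.cong)
    fix S assume "S \<in> Pow {1..n}"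
    then have "Suc n \<notin> S" by auto
    then show "g S * nc_eval_word sub_amb_b (u_word (Suc n) S) v
        = g S * nc_mult (?h S) (\<lambda>v. nc_a v - nc_b v) v"
      by (simp add: u_word_Suc nc_eval_word_snoc sub_amb_b_def)
  qed simp
  also have "(\<Sum>S\<in>insert (Suc n) ` Pow {1..n}. g S * nc_eval_word sub_amb_b (u_word (Suc n) S) v)
      = (\<Sum>S\<in>Pow {1..n}. g (insert (Suc n) S) * nc_mult (?h S) nc_b v)"
    by (subst sum.reindex[OF inj])
      (simp add: u_word_Suc nc_eval_word_snoc sub_amb_b_def u_word_insert)
  finally have eq: "flag_poly (Suc n) g v
      = (\<Sum>S\<in>Pow {1..n}. g S * nc_mult (?h S) (\<lambda>v. nc_a v - nc_b v) v)
      + (\<Sum>S\<in>Pow {1..n}. g (insert (Suc n) S) * nc_mult (?h S) nc_b v)" .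
  show ?thesis
  proof (cases v rule: rev_cases)
    case Nil
    then show ?thesis unfolding eq by (simp add: nc_mult_diff_right)
  next
    case (snoc u x)
    then show ?thesis unfolding eq
      by (cases x) (simp_all add: nc_mult_diff_right flag_poly_def sum_negf)
  qed
qed

lemma flag_poly_Suc_snoc [simp]:
  "flag_poly (Suc n) g [] = 0"
  "flag_poly (Suc n) g (u @ [x])
     = (if x then flag_poly n (\<lambda>T. g (insert (Suc n) T)) u - flag_poly n g u else flag_poly n g u)"
  by (simp_all add: flag_poly_Suc)

lemma flag_poly_cong:
  "(\<And>S. S \<subseteq> {1..n} \<Longrightarrow> g S = h S) \<Longrightarrow> flag_poly n g = flag_poly n h"
  unfolding flag_poly_def by (intro ext sum.cong) auto

lemma flag_poly_sum:
  "flag_poly n (\<lambda>S. \<Sum>i\<in>I. k i * g i S) v = (\<Sum>i\<in>I. k i * flag_poly n (g i) v)"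
  unfolding flag_poly_def sum_distrib_left sum_distrib_right
  by (subst sum.swap) (simp add: mult.assoc)

lemma flag_poly_diff: "flag_poly n (\<lambda>S. g S - h S) v = flag_poly n g v - flag_poly n h v"
  by (simp add: flag_poly_def left_diff_distrib sum_subtractf)

lemma flag_poly_add: "flag_poly n (\<lambda>S. g S + h S) v = flag_poly n g v + flag_poly n h v"
  by (simp add: flag_poly_def distrib_right sum.distrib)

lemma flag_poly_scale: "flag_poly n (\<lambda>S. k * g S) v = k * flag_poly n g v"
  by (simp add: flag_poly_def sum_distrib_left mult.assoc)

section \<open>Multinomial coefficients and descent enumerators\<close>

fun max_upto :: "nat \<Rightarrow> nat set \<Rightarrow> nat" where
  "max_upto 0 T = 0"
| "max_upto (Suc n) T = (if Suc n \<in> T then Suc n else max_upto n T)"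

text \<open>For \<open>T = {t1 < ... < tk}\<close> inside \<open>{1..n}\<close> this is the product
  of the binomials \<open>t(j+1) choose tj\<close>, the number of flags with ranks
  \<open>t1, ..., t(k-1)\<close> in a Boolean algebra of rank \<open>tk\<close>. The value 0 of
  \<open>max_upto\<close> for the empty set makes the smallest rank contribute the factor 1.\<close>

fun multinom :: "nat \<Rightarrow> nat set \<Rightarrow> nat" where
  "multinom 0 T = 1"
| "multinom (Suc n) T
     = (if Suc n \<in> T then (Suc n choose max_upto n T) * multinom n T else multinom n T)"

lemma max_upto_le: "max_upto n T \<le> n"
  by (induction n) auto

lemma max_upto_insert: "n < s \<Longrightarrow> max_upto n (insert s T) = max_upto n T"
  by (induction n) auto

lemma multinom_insert: "n < s \<Longrightarrow> multinom n (insert s T) = multinom n T"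
  by (induction n) (auto simp: max_upto_insert)

lemma max_upto_eq_0: "T \<subseteq> {1..n} \<Longrightarrow> max_upto n T = 0 \<longleftrightarrow> T = {}"
proof (induction n)
  case (Suc n)
  then show ?case by (cases "Suc n \<in> T") (auto simp: atLeastAtMostSuc_conv subset_insert)
qed simp

text \<open>
  For \<open>m \<le> n + 1\<close>, \<open>last_le_poly n m\<close> enumerates the permutations of \<open>{1..n + 1}\<close> with last
  letter at most \<open>m\<close> by their words of ascents (\<open>a\<close>) and descents (\<open>b\<close>).
\<close>

definition last_le_poly :: "nat \<Rightarrow> nat \<Rightarrow> ncpoly" where
  "last_le_poly n m = flag_poly n (\<lambda>T. int (multinom n T) * int (m choose (Suc n - max_upto n T)))"

text \<open>The polynomial \<open>Psi_i\<close> of degree \<open>Suc n\<close>; the first argument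
  is one less than the degree. It turns out to be the value of \<open>check_Phi (Suc n) i\<close>
  under the cd-substitution.\<close>

definition check_poly :: "nat \<Rightarrow> nat \<Rightarrow> ncpoly" where
  "check_poly n i = (\<lambda>v. nc_mult (last_le_poly n (Suc n - i)) nc_a v
     + nc_mult (\<lambda>u. last_le_poly n (Suc n) u - last_le_poly n i u) nc_b v)"

lemma last_le_poly_0: "last_le_poly n 0 v = 0"
proof -
  have "(0 choose (Suc n - max_upto n T)) = 0" for T
    using max_upto_le[of n T] by (intro binomial_eq_0) simp
  then show ?thesis unfolding last_le_poly_def flag_poly_def by (simp only: of_nat_0) simp
qed

lemma last_le_poly_degree_0: "last_le_poly 0 m v = int m * nc_one v"
  by (simp add: last_le_poly_def flag_poly_0)

lemma last_le_poly_Suc_Nil [simp]: "last_le_poly (Suc n) m [] = 0"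
  by (simp add: last_le_poly_def)

text \<open>This is Pascal's rule. For permutations of \<open>{1..n + 2}\<close> it adds those with
  last letter \<open>Suc m\<close>: after deleting that letter and standardizing, the new last
  letter is at most \<open>m\<close> if the final step was an ascent and greater than
  \<open>m\<close> if it was a descent.\<close>

lemma last_le_poly_Suc_Suc:
  "last_le_poly (Suc n) (Suc m) (u @ [x]) = last_le_poly (Suc n) m (u @ [x])
     + (if x then last_le_poly n (Suc n) u - last_le_poly n m u else last_le_poly n m u)"
proof -
  have a: "flag_poly n (\<lambda>T. int (multinom (Suc n) T) * int (Suc m choose (Suc (Suc n) - max_upto (Suc n) T))) u
     = flag_poly n (\<lambda>T. int (multinom (Suc n) T) * int (m choose (Suc (Suc n) - max_upto (Suc n) T))) u
      + last_le_poly n m u"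
    unfolding last_le_poly_def flag_poly_add[symmetric]
  proof (rule fun_cong[OF flag_poly_cong])
    fix T assume "T \<subseteq> {1..n}"
    then have "Suc n \<notin> T" by auto
    then show "int (multinom (Suc n) T) * int (Suc m choose (Suc (Suc n) - max_upto (Suc n) T))
      = int (multinom (Suc n) T) * int (m choose (Suc (Suc n) - max_upto (Suc n) T))
      + int (multinom n T) * int (m choose (Suc n - max_upto n T))"
      using max_upto_le[of n T] by (simp add: Suc_diff_le algebra_simps)
  qed
  \<comment> \<open>Here the largest rank is \<open>Suc n\<close>, so the binomial is
    \<open>k choose 1\<close>. The factor that \<open>multinom\<close> gains is, by symmetry, the
    binomial of \<open>last_le_poly\<close> at the full bound \<open>Suc n\<close>.\<close>
  have b: "flag_poly n (\<lambda>T. int (multinom (Suc n) (insert (Suc n) T))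
          * int (k choose (Suc (Suc n) - max_upto (Suc n) (insert (Suc n) T)))) u
      = int k * last_le_poly n (Suc n) u" for k
    unfolding last_le_poly_def flag_poly_scale[symmetric]
  proof (rule fun_cong[OF flag_poly_cong])
    fix T assume "T \<subseteq> {1..n}"
    have "Suc n choose max_upto n T = Suc n choose (Suc n - max_upto n T)"
      using max_upto_le[of n T] by (intro binomial_symmetric) simp
    then show "int (multinom (Suc n) (insert (Suc n) T))
          * int (k choose (Suc (Suc n) - max_upto (Suc n) (insert (Suc n) T)))
      = int k * (int (multinom n T) * int (Suc n choose (Suc n - max_upto n T)))"
      by (simp add: max_upto_insert multinom_insert)
  qed
  show ?thesis
    unfolding last_le_poly_def[of "Suc n"] flag_poly_Suc_snoc a b
    by (simp add: algebra_simps)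
qed

lemma last_le_poly_eq_sum:
  "last_le_poly (Suc n) m (u @ [x])
     = (\<Sum>j<m. if x then last_le_poly n (Suc n) u - last_le_poly n j u else last_le_poly n j u)"
  by (induction m) (simp_all add: last_le_poly_Suc_Suc last_le_poly_0)

lemma check_poly_snoc [simp]:
  "check_poly n i [] = 0"
  "check_poly n i (u @ [x]) = (if x then last_le_poly n (Suc n) u - last_le_poly n i u
     else last_le_poly n (Suc n - i) u)"
  by (simp_all add: check_poly_def)

lemma check_poly_top: "check_poly n (Suc n) v = 0"
  by (cases v rule: rev_cases) (simp_all add: last_le_poly_0)

text \<open>Pascal's rule in the form \<open>last_le_poly_Suc_Suc\<close>, applied to both halves of
  \<open>check_poly\<close>, yields the identity on each choice of the last two letters. The step
  from \<open>Suc i\<close> to \<open>i\<close> thus adds only multiples of \<open>c\<close> and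
  \<open>d\<close> with left factors of lower degree.\<close>

lemma check_poly_rec:
  assumes "i \<le> Suc n"
  shows "check_poly (Suc n) i v = check_poly (Suc n) (Suc i) v
    + nc_mult (check_poly n i) (cd_subst cC) v
    + nc_mult (\<lambda>u. last_le_poly n i u - last_le_poly n (Suc n - i) u) (cd_subst cD) v"
proof (cases v rule: rev_cases)
  case Nil
  then show ?thesis by (simp add: nc_mult_cC nc_mult_cD)
next
  case v: (snoc u x)
  have i: "Suc (Suc n) - i = Suc (Suc n - i)" using assms by simp
  show ?thesis
  proof (cases u rule: rev_cases)
    case Nil
    have "[x] = [] @ [x]" by simp
    show ?thesis unfolding v Nil
      by (simp only: check_poly_snoc nc_mult_cC nc_mult_cD nc_mult_var_right) simp
  next
    case u: (snoc w y)
    show ?thesis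
      unfolding v u check_poly_snoc nc_mult_cC nc_mult_cD nc_mult_var_right diff_Suc_Suc i
        last_le_poly_Suc_Suc by (cases x; cases y) simp_all
  qed
qed

text \<open>Controls the left factor of \<open>d\<close> in \<open>check_poly_rec\<close>: its
  increments in \<open>i\<close> are sums of two polynomials \<open>check_poly\<close> of the same
  degree.\<close>

lemma last_le_poly_diff_rec:
  assumes "i \<le> Suc n"
  shows "last_le_poly (Suc n) (Suc i) v - last_le_poly (Suc n) (Suc (Suc n) - Suc i) v
    = (last_le_poly (Suc n) i v - last_le_poly (Suc n) (Suc (Suc n) - i) v)
      + check_poly n i v + check_poly n (Suc n - i) v"
proof (cases v rule: rev_cases)
  case v: (snoc u x)
  have i: "Suc (Suc n) - i = Suc (Suc n - i)" using assms by simp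
  show ?thesis
    unfolding v check_poly_snoc diff_Suc_Suc i last_le_poly_Suc_Suc
    using assms by (cases x) simp_all
qed simp

text \<open>Both sides are expanded by the last letter; the sums over bounds agree after reversing
  the order of summation. It supplies the start \<open>i = 0\<close> for the induction on the
  differences.\<close>

lemma last_le_poly_total:
  "last_le_poly (Suc n) (Suc (Suc n)) v = (\<Sum>i<Suc (Suc n). check_poly n i v)"
proof (cases v rule: rev_cases)
  case v: (snoc u x)
  have "(\<Sum>i<Suc (Suc n). last_le_poly n i u) = (\<Sum>i<Suc (Suc n). last_le_poly n (Suc n - i) u)"
    using sum.nat_diff_reindex[of "\<lambda>i. last_le_poly n i u" "Suc (Suc n)"] by simp
  then show ?thesis
    unfolding v last_le_poly_eq_sum check_poly_snoc by (cases x) (simp_all del: sum.lessThan_Suc)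
qed simp

text \<open>The two claims feed each other, so they are proved together by induction on the degree.
  Within a degree, \<open>check_poly\<close> descends from the top index, where it vanishes, and the
  differences ascend from index 0.\<close>

lemma check_poly_in_cd_image_aux:
  "(\<forall>i \<le> Suc n. check_poly n i \<in> cd_image) \<and>
   (\<forall>i \<le> Suc n. (\<lambda>v. last_le_poly n i v - last_le_poly n (Suc n - i) v) \<in> cd_image)"
proof (induction n)
  case 0
  have one: "nc_one \<in> cd_image"
    using nc_eval_word_in_cd_image[of "[]"] by (simp add: nc_eval_word_Nil)
  have "check_poly 0 0 = nc_mult nc_one (cd_subst cC)"
    by (rule ext) (simp add: check_poly_def last_le_poly_degree_0[abs_def] nc_mult_cC)
  then have "check_poly 0 0 \<in> cd_image" using cd_image_snoc[OF one] by simp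
  moreover have "check_poly 0 (Suc 0) = (\<lambda>v. 0)" using check_poly_top[of 0] by blast
  then have "check_poly 0 (Suc 0) \<in> cd_image" using cd_image_zero by simp
  ultimately have "\<forall>i \<le> Suc 0. check_poly 0 i \<in> cd_image" by (auto simp: le_Suc_eq)
  moreover have "(\<lambda>v. last_le_poly 0 i v - last_le_poly 0 (Suc 0 - i) v) \<in> cd_image" for i
    using cd_image_lin[OF cd_image_zero one, of "int i - int (Suc 0 - i)"]
    by (simp add: last_le_poly_degree_0 algebra_simps)
  ultimately show ?case by blast
next
  case (Suc n)
  \<comment> \<open>The variable \<open>k\<close> is the distance from the top index, so that
    ordinary induction on \<open>k\<close> is descent in the index.\<close>
  have check: "check_poly (Suc n) (Suc (Suc n) - k) \<in> cd_image" if "k \<le> Suc (Suc n)" for k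
    using that
  proof (induction k)
    case 0
    have "check_poly (Suc n) (Suc (Suc n)) = (\<lambda>v. 0)" using check_poly_top by blast
    then show ?case using cd_image_zero by simp
  next
    case (Suc k)
    let ?i = "Suc n - k"
    have i: "?i \<le> Suc n" "Suc (Suc n) - k = Suc ?i" using Suc.prems by auto
    have "check_poly (Suc n) ?i = (\<lambda>v. check_poly (Suc n) (Suc ?i) v
      + nc_mult (check_poly n ?i) (cd_subst cC) v
      + nc_mult (\<lambda>u. last_le_poly n ?i u - last_le_poly n (Suc n - ?i) u) (cd_subst cD) v)"
      using check_poly_rec[OF i(1)] by blast
    moreover have "\<dots> \<in> cd_image"
    proof (intro cd_image_add cd_image_snoc)
      show "check_poly (Suc n) (Suc ?i) \<in> cd_image" using Suc.IH Suc.prems i by simp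
      show "check_poly n ?i \<in> cd_image"
        "(\<lambda>u. last_le_poly n ?i u - last_le_poly n (Suc n - ?i) u) \<in> cd_image"
        using \<open>(\<forall>i\<le>Suc n. check_poly n i \<in> cd_image) \<and> _\<close> i(1) by blast+
    qed
    ultimately show ?case by simp
  qed
  have "(\<lambda>v. last_le_poly (Suc n) i v - last_le_poly (Suc n) (Suc (Suc n) - i) v) \<in> cd_image"
    if "i \<le> Suc (Suc n)" for i
    using that
  proof (induction i)
    case 0
    \<comment> \<open>At index 0 the difference is minus the enumerator of all permutations, which
      is a sum of polynomials already known to be in the image.\<close>
    have "(\<lambda>v. \<Sum>i<Suc (Suc n). -1 * check_poly n i v) \<in> cd_image"
      using \<open>(\<forall>i\<le>Suc n. check_poly n i \<in> cd_image) \<and> _\<close> by (intro cd_image_sum) auto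
    then show ?case
      unfolding diff_zero last_le_poly_total last_le_poly_0 by (simp add: sum_negf del: sum.lessThan_Suc)
  next
    case (Suc i)
    then have i: "i \<le> Suc n" by simp
    show ?case
      unfolding last_le_poly_diff_rec[OF i]
      using Suc \<open>(\<forall>i\<le>Suc n. check_poly n i \<in> cd_image) \<and> _\<close> by (intro cd_image_add) auto
  qed
  moreover have "check_poly (Suc n) i \<in> cd_image" if "i \<le> Suc (Suc n)" for i
    using check[of "Suc (Suc n) - i"] that by simp
  ultimately show ?case by blast
qed

lemma check_poly_in_cd_image: "i \<le> Suc n \<Longrightarrow> check_poly n i \<in> cd_image"
  using check_poly_in_cd_image_aux by blast

text \<open>Reduces an identity of polynomials to two families of numbers, for rank sets without and
  with the top rank. The coefficient of a final \<open>b\<close> is a difference of the two, so the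
  common binomial in \<open>Suc n - i\<close> cancels there and the coefficient of \<open>b\<close>
  in \<open>check_poly\<close> remains.\<close>

lemma flag_poly_eq_check_poly_sum:
  assumes "\<And>T. T \<subseteq> {1..n} \<Longrightarrow> g T
      = int (multinom n T) * (\<Sum>i\<in>I. k i * int ((Suc n - i) choose (Suc n - max_upto n T)))"
    and "\<And>T. T \<subseteq> {1..n} \<Longrightarrow> g (insert (Suc n) T)
      = int (multinom n T) * (\<Sum>i\<in>I. k i * (int (Suc n choose max_upto n T)
          + int ((Suc n - i) choose (Suc n - max_upto n T)) - int (i choose (Suc n - max_upto n T))))"
  shows "flag_poly (Suc n) g = (\<lambda>v. \<Sum>i\<in>I. k i * check_poly n i v)"
proof
  fix v
  have sym: "Suc n choose max_upto n T = Suc n choose (Suc n - max_upto n T)" for T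
    using max_upto_le[of n T] by (intro binomial_symmetric) simp
  have a: "flag_poly n g u = (\<Sum>i\<in>I. k i * last_le_poly n (Suc n - i) u)" for u
    unfolding last_le_poly_def flag_poly_sum[symmetric]
    by (rule fun_cong[OF flag_poly_cong]) (simp add: assms(1) sum_distrib_left mult_ac)
  have b: "flag_poly n (\<lambda>T. g (insert (Suc n) T)) u = (\<Sum>i\<in>I. k i *
      (last_le_poly n (Suc n) u + last_le_poly n (Suc n - i) u - last_le_poly n i u))" for u
    unfolding last_le_poly_def flag_poly_sum[symmetric] flag_poly_add[symmetric] flag_poly_diff[symmetric]
    by (rule fun_cong[OF flag_poly_cong])
      (simp add: assms(2) sym sum_distrib_left algebra_simps)
  show "flag_poly (Suc n) g v = (\<Sum>i\<in>I. k i * check_poly n i v)"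
    by (cases v rule: rev_cases) (auto simp: a b sum_subtractf[symmetric] algebra_simps intro!: sum.cong)
qed

subsection \<open>Flag numbers of posets with Boolean lower intervals\<close>

text \<open>What the counting of chains rests on: a bounded finite order with strictly increasing
  rank. Both graded posets and the face posets of the semisuspensions are instances.\<close>

locale ranked_poset =
  fixes X :: "'a set" and le :: "'a \<Rightarrow> 'a \<Rightarrow> bool" and rk :: "'a \<Rightarrow> nat" and z0 z1 :: 'a
  assumes finite_carrier: "finite X"
    and le_refl: "x \<in> X \<Longrightarrow> le x x"
    and le_antisym: "x \<in> X \<Longrightarrow> y \<in> X \<Longrightarrow> le x y \<Longrightarrow> le y x \<Longrightarrow> x = y"
    and le_trans: "x \<in> X \<Longrightarrow> y \<in> X \<Longrightarrow> z \<in> X \<Longrightarrow> le x y \<Longrightarrow> le y z \<Longrightarrow> le x z"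
    and bot_in: "z0 \<in> X" and top_in: "z1 \<in> X"
    and bot_le: "x \<in> X \<Longrightarrow> le z0 x" and le_top: "x \<in> X \<Longrightarrow> le x z1"
    and rk_bot: "rk z0 = 0"
    and rk_less: "x \<in> X \<Longrightarrow> y \<in> X \<Longrightarrow> lt_on le x y \<Longrightarrow> rk x < rk y"
begin

definition rank_below :: "nat \<Rightarrow> 'a \<Rightarrow> nat" where
  "rank_below l x = card {y \<in> X. lt_on le y x \<and> rk y = l}"

text \<open>An arbitrary upper end \<open>x\<close> in place of \<open>z1\<close> allows recursion:
  once its largest element \<open>y\<close> is removed, a chain below \<open>x\<close> becomes a
  chain below \<open>y\<close>.\<close>

definition chains_below :: "'a \<Rightarrow> nat set \<Rightarrow> 'a set set" where
  "chains_below x T = {C. C \<subseteq> X - {z0} \<and> (\<forall>y\<in>C. lt_on le y x) \<and>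
     (\<forall>y\<in>C. \<forall>z\<in>C. le y z \<or> le z y) \<and> card C = card T \<and> rk ` C = T}"

lemma flag_f_eq_chains: "flag_f X le rk z0 z1 S = card (chains_below z1 S)"
proof -
  have "C \<subseteq> X - {z0, z1} \<longleftrightarrow> C \<subseteq> X - {z0} \<and> (\<forall>y\<in>C. lt_on le y z1)" for C
    using le_top by (auto simp: lt_on_def)
  then show ?thesis unfolding flag_f_def chains_below_def by (simp only: conj_assoc)
qed

lemma rk_mono: "x \<in> X \<Longrightarrow> y \<in> X \<Longrightarrow> le x y \<Longrightarrow> rk x \<le> rk y"
  using rk_less[of x y] by (cases "x = y") (auto simp: lt_on_def)

lemma lt_on_trans: "x \<in> X \<Longrightarrow> y \<in> X \<Longrightarrow> z \<in> X \<Longrightarrow> lt_on le x y \<Longrightarrow> lt_on le y z \<Longrightarrow> lt_on le x z"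
  unfolding lt_on_def using le_trans le_antisym by blast

lemma rk_eq_0: "x \<in> X \<Longrightarrow> rk x = 0 \<longleftrightarrow> x = z0"
  using rk_less[of z0 x] bot_in bot_le rk_bot by (cases "x = z0") (auto simp: lt_on_def)

lemma finite_chains_below: "finite (chains_below x T)"
  by (rule finite_subset[of _ "Pow X"]) (auto simp: chains_below_def finite_carrier)

lemma rank_below_0: "x \<in> X \<Longrightarrow> x \<noteq> z0 \<Longrightarrow> rank_below 0 x = 1"
proof -
  assume "x \<in> X" "x \<noteq> z0"
  then have "{y \<in> X. lt_on le y x \<and> rk y = 0} = {z0}"
    using rk_eq_0 bot_in bot_le by (auto simp: lt_on_def)
  then show "rank_below 0 x = 1" by (simp add: rank_below_def)
qed

lemma chains_below_empty: "card (chains_below x {}) = 1"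
proof -
  have "chains_below x {} = {{}}" by (auto simp: chains_below_def)
  then show ?thesis by simp
qed

text \<open>The last two conclusions recover the new element and the old chain from the enlarged
  chain, which gives injectivity in \<open>card_chains_below_insert\<close>.\<close>

lemma insert_chain:
  assumes x: "x \<in> X" and s: "0 < s" "finite T" "\<forall>t\<in>T. t < s"
    and y: "y \<in> X" "lt_on le y x" "rk y = s" and C: "C \<in> chains_below y T"
  shows "insert y C \<in> chains_below x (insert s T)" and "y \<notin> C" and "{z \<in> insert y C. rk z = s} = {y}"
proof -
  have C': "C \<subseteq> X - {z0}" "\<forall>z\<in>C. lt_on le z y" "\<forall>z\<in>C. \<forall>w\<in>C. le z w \<or> le w z"
    "card C = card T" "rk ` C = T"
    using C by (auto simp: chains_below_def)
  have fin: "finite C" using C'(1) finite_carrier finite_subset by blast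
  show yC: "y \<notin> C" using C'(2) by (auto simp: lt_on_def)
  have "y \<noteq> z0" using s(1) y(3) rk_bot by auto
  moreover have "lt_on le z x" if "z \<in> C" for z
    using lt_on_trans[of z y x] C'(1,2) x y that by blast
  moreover have "card (insert y C) = card (insert s T)"
    using fin yC s C'(4) by (simp add: card_insert_if) blast
  ultimately show "insert y C \<in> chains_below x (insert s T)"
    using C' y le_refl by (auto simp: chains_below_def lt_on_def)
  have "rk z < s" if "z \<in> C" for z using C'(5) s(3) that by blast
  then show "{z \<in> insert y C. rk z = s} = {y}" using y(3) by fastforce
qed

lemma remove_top_of_chain:
  assumes x: "x \<in> X" and s: "finite T" "\<forall>t\<in>T. t < s"
    and D: "D \<in> chains_below x (insert s T)"
  obtains y C where "y \<in> X" "lt_on le y x" "rk y = s" "C \<in> chains_below y T" "D = insert y C"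
proof -
  have D': "D \<subseteq> X - {z0}" "\<forall>z\<in>D. lt_on le z x" "\<forall>z\<in>D. \<forall>w\<in>D. le z w \<or> le w z"
    "card D = card (insert s T)" "rk ` D = insert s T"
    using D by (auto simp: chains_below_def)
  have fin: "finite D" using D'(1) finite_carrier finite_subset by blast
  \<comment> \<open>A chain has as many elements as ranks, so each rank is attained once and
    removing \<open>y\<close> removes exactly the rank \<open>s\<close>.\<close>
  have inj: "inj_on rk D" using D'(4,5) fin by (intro eq_card_imp_inj_on) auto
  obtain y where y: "y \<in> D" "rk y = s" using D'(5) by (metis imageE insertI1)
  have sT: "s \<notin> T" using s(2) by blast
  have "rk ` (D - {y}) = T"
    using inj_on_image_set_diff[OF inj, of D "{y}"] y D'(5) sT by auto
  moreover have "card (D - {y}) = card T"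
    using D'(4) y fin s sT by simp
  moreover have "lt_on le z y" if "z \<in> D - {y}" for z
  proof -
    have "rk z \<in> T" using \<open>rk ` (D - {y}) = T\<close> that by blast
    then have "\<not> le y z" using rk_mono[of y z] s(2) y that D'(1) by fastforce
    then show ?thesis using D'(3) y(1) that by (auto simp: lt_on_def)
  qed
  ultimately have "D - {y} \<in> chains_below y T"
    using D' by (auto simp: chains_below_def)
  then show ?thesis using that[of y "D - {y}"] y D' by (auto simp: insert_absorb)
qed

lemma card_chains_below_insert:
  assumes "x \<in> X" "0 < s" "finite T" "\<forall>t\<in>T. t < s"
  shows "card (chains_below x (insert s T))
    = (\<Sum>y\<in>{y \<in> X. lt_on le y x \<and> rk y = s}. card (chains_below y T))"
proof -
  let ?Y = "{y \<in> X. lt_on le y x \<and> rk y = s}"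
  let ?f = "\<lambda>(y, C). insert y C"
  have inj: "inj_on ?f (SIGMA y:?Y. chains_below y T)"
  proof (rule inj_onI, clarify)
    fix y C y' C'
    assume *: "y \<in> X" "lt_on le y x" "s = rk y" "C \<in> chains_below y T"
      "y' \<in> X" "lt_on le y' x" "rk y' = rk y" "C' \<in> chains_below y' T" "insert y C = insert y' C'"
    then have "{y} = {y'}"
      using insert_chain(3)[of x s T y C] insert_chain(3)[of x s T y' C'] assms by metis
    moreover have "y \<notin> C" "y' \<notin> C'"
      using * insert_chain(2)[of x s T y C] insert_chain(2)[of x s T y' C'] assms by metis+
    ultimately show "y = y' \<and> C = C'" using *(9) by (metis Diff_insert_absorb singleton_inject)
  qed
  have image: "?f ` (SIGMA y:?Y. chains_below y T) = chains_below x (insert s T)"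
  proof (intro equalityI subsetI)
    fix D assume "D \<in> ?f ` (SIGMA y:?Y. chains_below y T)"
    then show "D \<in> chains_below x (insert s T)"
      using insert_chain(1)[OF assms] by auto
  next
    fix D assume D: "D \<in> chains_below x (insert s T)"
    obtain y C where "y \<in> X" "lt_on le y x" "rk y = s" "C \<in> chains_below y T" "D = insert y C"
      using remove_top_of_chain[OF assms(1,3,4) D] .
    then show "D \<in> ?f ` (SIGMA y:?Y. chains_below y T)"
      by (intro image_eqI[of _ _ "(y, C)"]) auto
  qed
  have "card (chains_below x (insert s T)) = card (SIGMA y:?Y. chains_below y T)"
    using card_image[OF inj] unfolding image .
  also have "\<dots> = (\<Sum>y\<in>?Y. card (chains_below y T))"
    using finite_carrier finite_chains_below by (intro card_SigmaI) auto
  finally show ?thesis .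
qed

text \<open>Remove the largest element of the chain and apply induction below it. The binomial
  condition concerns only elements strictly below \<open>x\<close>, so \<open>x\<close> may also be
  the top element or the cell \<open>Tau\<close>; this is why \<open>rank_below\<close> remains in
  the result.\<close>

lemma card_chains_below_boolean:
  assumes boolean: "\<And>y l. y \<in> X \<Longrightarrow> lt_on le y x \<Longrightarrow> 0 < rk y \<Longrightarrow> rk y \<le> m \<Longrightarrow> l < rk y
      \<Longrightarrow> rank_below l y = rk y choose l"
    and x: "x \<in> X" "x \<noteq> z0" and T: "T \<subseteq> {1..m}"
  shows "card (chains_below x T) = multinom m T * rank_below (max_upto m T) x"
  using assms
proof (induction m arbitrary: x T)
  case 0
  then show ?case by (simp add: chains_below_empty rank_below_0)
next
  case (Suc m)
  show ?case
  proof (cases "Suc m \<in> T")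
    case False
    then have "T \<subseteq> {1..m}" using Suc.prems(4) by (auto simp: atLeastAtMostSuc_conv)
    then show ?thesis using Suc.IH[of x T] Suc.prems False by simp
  next
    case True
    define T' where "T' = T - {Suc m}"
    have T': "T = insert (Suc m) T'" "T' \<subseteq> {1..m}" "Suc m \<notin> T'"
      using True Suc.prems(4) by (auto simp: T'_def atLeastAtMostSuc_conv)
    have "finite T'" "\<forall>t\<in>T'. t < Suc m" using T'(2) finite_subset by fastforce+
    then have "card (chains_below x T)
        = (\<Sum>y\<in>{y \<in> X. lt_on le y x \<and> rk y = Suc m}. card (chains_below y T'))"
      unfolding T'(1) using Suc.prems(2) by (intro card_chains_below_insert) auto
    also have "\<dots> = (\<Sum>y\<in>{y \<in> X. lt_on le y x \<and> rk y = Suc m}.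
        multinom m T' * (Suc m choose max_upto m T'))"
    proof (rule sum.cong)
      fix y assume "y \<in> {y \<in> X. lt_on le y x \<and> rk y = Suc m}"
      then have y: "y \<in> X" "lt_on le y x" "rk y = Suc m" by auto
      have "rank_below l w = rk w choose l"
        if "w \<in> X" "lt_on le w y" "0 < rk w" "rk w \<le> m" "l < rk w" for w l
        using Suc.prems(1)[of w l] lt_on_trans[of w y x] that y Suc.prems(2) by simp
      moreover have "y \<noteq> z0" using y(3) rk_bot by auto
      ultimately have "card (chains_below y T') = multinom m T' * rank_below (max_upto m T') y"
        using Suc.IH[of y T'] y(1) T'(2) by blast
      also have "rank_below (max_upto m T') y = Suc m choose max_upto m T'"
        using Suc.prems(1)[OF y(1,2), of "max_upto m T'"] y(3) max_upto_le[of m T'] by simp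
      finally show "card (chains_below y T') = multinom m T' * (Suc m choose max_upto m T')" .
    qed simp
    also have "\<dots> = multinom (Suc m) T * rank_below (max_upto (Suc m) T) x"
      by (simp add: T' rank_below_def multinom_insert max_upto_insert)
    finally show ?thesis .
  qed
qed

definition rank_num :: "nat \<Rightarrow> nat" where
  "rank_num l = card {x \<in> X. rk x = l}"

lemma rank_below_top: "l < rk z1 \<Longrightarrow> rank_below l z1 = rank_num l"
proof -
  assume "l < rk z1"
  then have "{y \<in> X. lt_on le y z1 \<and> rk y = l} = {y \<in> X. rk y = l}"
    using le_top by (auto simp: lt_on_def)
  then show ?thesis by (simp add: rank_below_def rank_num_def)
qed

lemma flag_f_singleton:
  assumes "0 < j" "j < rk z1"
  shows "flag_f X le rk z0 z1 {j} = rank_num j"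
proof -
  have "card (chains_below z1 {j}) = rank_below j z1"
    using card_chains_below_insert[OF top_in assms(1), of "{}"]
    by (simp add: chains_below_empty rank_below_def)
  then show ?thesis using assms(2) by (simp add: flag_f_eq_chains rank_below_top)
qed

lemma euler_chi_eq:
  "euler_chi X le rk z0 z1 = (\<Sum>j = 1..rk z1 - 1. (-1) ^ (j - 1) * int (rank_num j))"
  unfolding euler_chi_def pn_def by (intro sum.cong) (auto simp: flag_f_singleton)

text \<open>Flag numbers depend on the rank set only through a multinomial factor and its largest
  rank below the top one. This leaves three numerical conditions: the face numbers, the incidences
  with facets, and the corrected facet number, which has the shape of the incidence condition at
  \<open>l = 0\<close>.\<close>

lemma chi'_sub_eq_check_poly_sum:
  assumes top: "rk z1 = Suc (Suc m)"
    and boolean: "\<And>y l. y \<in> X \<Longrightarrow> 0 < rk y \<Longrightarrow> rk y \<le> m \<Longrightarrow> l < rk y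
      \<Longrightarrow> rank_below l y = rk y choose l"
    and lower: "\<And>l. l \<le> m \<Longrightarrow>
      int (rank_num l) = (\<Sum>i\<in>I. k i * int ((Suc m - i) choose (Suc m - l)))"
    and upper: "\<And>l. 0 < l \<Longrightarrow> l \<le> m \<Longrightarrow>
      (\<Sum>y\<in>{y \<in> X. rk y = Suc m}. int (rank_below l y))
        = (\<Sum>i\<in>I. k i * (int (Suc m choose l) + int ((Suc m - i) choose (Suc m - l))
          - int (i choose (Suc m - l))))"
    and facets: "int (rank_num (Suc m)) + chi_sphere (Suc m) - euler_chi X le rk z0 z1
        = (\<Sum>i\<in>I. k i * (1 + int ((Suc m - i) choose (Suc m)) - int (i choose (Suc m))))"
  shows "chi'_sub X le rk z0 z1 = (\<lambda>v. \<Sum>i\<in>I. k i * check_poly m i v)"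
proof -
  let ?F = "flag_f' X le rk z0 z1"
  have pn: "pn rk z1 = Suc m" by (simp add: pn_def top)
  have "z1 \<noteq> z0" using top rk_bot by auto
  have less_top: "{y \<in> X. lt_on le y z1 \<and> rk y = Suc m} = {y \<in> X. rk y = Suc m}"
    using le_top top by (auto simp: lt_on_def)
  have chains: "card (chains_below x T) = multinom m T * rank_below (max_upto m T) x"
    if "x \<in> X" "x \<noteq> z0" "T \<subseteq> {1..m}" for x T
    using card_chains_below_boolean[of x m T] boolean that by blast
  have "chi'_sub X le rk z0 z1 = flag_poly (Suc m) ?F"
    unfolding chi'_sub_def flag_poly_def pn ..
  also have "flag_poly (Suc m) ?F = (\<lambda>v. \<Sum>i\<in>I. k i * check_poly m i v)"
  proof (rule flag_poly_eq_check_poly_sum)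
    fix T assume T: "T \<subseteq> {1..m}"
    let ?l = "max_upto m T"
    have l: "?l \<le> m" by (rule max_upto_le)
    have "T \<noteq> {Suc m}" using T by auto
    then have "?F T = int (multinom m T * rank_below ?l z1)"
      using chains[OF top_in \<open>z1 \<noteq> z0\<close> T] by (simp add: flag_f'_def pn flag_f_eq_chains)
    also have "\<dots> = int (multinom m T) * int (rank_num ?l)"
      using l top by (simp add: rank_below_top)
    finally show "?F T = int (multinom m T)
        * (\<Sum>i\<in>I. k i * int ((Suc m - i) choose (Suc m - ?l)))"
      using lower[OF l] by simp
    have "finite T" "\<forall>t\<in>T. t < Suc m" using T finite_subset by fastforce+
    then have "flag_f X le rk z0 z1 (insert (Suc m) T)
        = (\<Sum>y\<in>{y \<in> X. rk y = Suc m}. card (chains_below y T))"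
      using card_chains_below_insert[OF top_in, of "Suc m" T] less_top
      by (simp add: flag_f_eq_chains)
    also have "\<dots> = (\<Sum>y\<in>{y \<in> X. rk y = Suc m}. multinom m T * rank_below ?l y)"
    proof (intro sum.cong refl)
      fix y assume "y \<in> {y \<in> X. rk y = Suc m}"
      then have "y \<in> X" "y \<noteq> z0" using rk_bot by auto
      then show "card (chains_below y T) = multinom m T * rank_below ?l y"
        using chains T by blast
    qed
    finally have flag: "int (flag_f X le rk z0 z1 (insert (Suc m) T))
        = int (multinom m T) * (\<Sum>y\<in>{y \<in> X. rk y = Suc m}. int (rank_below ?l y))"
      by (simp add: sum_distrib_left)
    show "?F (insert (Suc m) T) = int (multinom m T) * (\<Sum>i\<in>I. k i *
        (int (Suc m choose ?l) + int ((Suc m - i) choose (Suc m - ?l)) - int (i choose (Suc m - ?l))))"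
    \<comment> \<open>The empty \<open>T\<close> gives the one set at which \<open>flag_f'\<close>
      carries the Euler correction.\<close>
    proof (cases "T = {}")
      case True
      have empty: "multinom m {} = 1" "max_upto m {} = 0" by (induction m) auto
      show ?thesis
        using facets flag_f_singleton[of "Suc m"] top
        by (simp add: True empty flag_f'_def pn)
    next
      case False
      then have "insert (Suc m) T \<noteq> {Suc m}" using T by auto
      moreover have "0 < ?l" using max_upto_eq_0[OF T] False by simp
      ultimately show ?thesis using flag upper[OF _ l] by (simp add: flag_f'_def pn)
    qed
  qed
  finally show ?thesis .
qed

end

subsection \<open>The h-vector transformation\<close>

lemma coeff_one_X_power: "coeff ([:1, 1:] ^ k) j = int (k choose j)"
  by (cases "j \<le> k") (simp_all add: coeff_linear_poly_power coeff_eq_0 degree_linear_power)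

lemma coeff_neg_one_X_power: "coeff ([:-1, 1:] ^ k) j = int (k choose j) * (-1) ^ (k - j)"
  by (cases "j \<le> k") (simp_all add: coeff_linear_poly_power coeff_eq_0 degree_linear_power)

text \<open>Substituting \<open>x + 1\<close> for \<open>x\<close> turns \<open>(x - 1) ^ M\<close>
  into \<open>x ^ M\<close>, and the sum is a coefficient of the result.\<close>

lemma sum_coeff_shift:
  assumes "M \<le> n"
  shows "(\<Sum>k\<le>n. coeff ([:-1, 1:] ^ M) (n - k) * int ((n - k) choose j)) = (if j = M then 1 else 0)"
proof -
  have "(\<Sum>k\<le>n. coeff ([:-1, 1:] ^ M) (n - k) * int ((n - k) choose j))
      = (\<Sum>k\<le>n. coeff ([:-1, 1:] ^ M) k * int (k choose j))"
    by (rule sum.reindex_bij_witness[of _ "\<lambda>k. n - k" "\<lambda>k. n - k"]) auto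
  also have "\<dots> = (\<Sum>k\<le>M. coeff ([:-1, 1:] ^ M) k * int (k choose j))"
    using assms by (intro sum.mono_neutral_right) (auto simp: coeff_neg_one_X_power)
  also have "\<dots> = coeff (\<Sum>k\<le>M. of_nat (M choose k) * [:1, 1:] ^ k * [:-1:] ^ (M - k)) j"
    by (simp add: coeff_sum coeff_neg_one_X_power of_nat_poly coeff_one_X_power poly_const_pow mult_ac)
  also have "\<dots> = coeff (([:1, 1:] + [:-1:]) ^ M) j"
    unfolding binomial_ring ..
  also have "[:1, 1:] + [:-1:] = (monom 1 1 :: int poly)"
    by (simp add: monom_altdef)
  finally show ?thesis by (simp add: monom_power)
qed

text \<open>With \<open>y = 1 + x\<close>, replacing each \<open>x ^ k\<close> in
  \<open>(x - 1) ^ (n - i)\<close> by \<open>y ^ (n - k)\<close> gives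
  \<open>y ^ i * (1 - y) ^ (n - i)\<close>, that is, \<open>(1 + x) ^ i * (- x) ^ (n - i)\<close>.
  The sum is its coefficient at \<open>n - l\<close>.\<close>

lemma sum_coeff_reflect:
  assumes "i \<le> n" "l \<le> n"
  shows "(\<Sum>k\<le>n. coeff ([:-1, 1:] ^ (n - i)) (n - k) * int (k choose (n - l)))
    = (-1) ^ (n - i) * int (i choose l)"
proof -
  let ?M = "n - i" and ?y = "[:1, 1:] :: int poly"
  have "(\<Sum>k\<le>n. coeff ([:-1, 1:] ^ ?M) (n - k) * int (k choose (n - l)))
      = (\<Sum>k\<le>n. coeff ([:-1, 1:] ^ ?M) k * int ((n - k) choose (n - l)))"
    by (rule sum.reindex_bij_witness[of _ "\<lambda>k. n - k" "\<lambda>k. n - k"]) auto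
  also have "\<dots> = (\<Sum>k\<le>?M. coeff ([:-1, 1:] ^ ?M) k * int ((n - k) choose (n - l)))"
    by (intro sum.mono_neutral_right) (auto simp: coeff_neg_one_X_power)
  also have "\<dots> = coeff (\<Sum>k\<le>?M. of_nat (?M choose k) * [:-1:] ^ (?M - k) * ?y ^ (n - k)) (n - l)"
    by (simp add: coeff_sum coeff_neg_one_X_power of_nat_poly coeff_one_X_power poly_const_pow mult_ac)
  also have "(\<Sum>k\<le>?M. of_nat (?M choose k) * [:-1:] ^ (?M - k) * ?y ^ (n - k))
      = ?y ^ i * (\<Sum>k\<le>?M. of_nat (?M choose k) * 1 ^ k * ([:-1:] * ?y) ^ (?M - k))"
    unfolding sum_distrib_left
  proof (rule sum.cong)
    fix k assume "k \<in> {..?M}"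
    then have "?y ^ (n - k) = ?y ^ i * ?y ^ (?M - k)"
      using assms(1) by (simp add: power_add[symmetric])
    then show "of_nat (?M choose k) * [:-1:] ^ (?M - k) * ?y ^ (n - k)
        = ?y ^ i * (of_nat (?M choose k) * 1 ^ k * ([:-1:] * ?y) ^ (?M - k))"
      by (simp only: power_mult_distrib power_one mult_ac mult_1_left)
  qed simp
  also have "\<dots> = ?y ^ i * (1 + [:-1:] * ?y) ^ ?M"
    unfolding binomial_ring ..
  also have "1 + [:-1:] * ?y = monom (-1) 1"
    by (simp add: monom_altdef one_pCons)
  also have "coeff (?y ^ i * monom (-1) 1 ^ ?M) (n - l)
      = (if ?M \<le> n - l then (-1) ^ ?M * coeff (?y ^ i) (n - l - ?M) else 0)"
    by (simp add: monom_power coeff_monom_mult mult.commute[of "?y ^ i"])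
  also have "\<dots> = (-1) ^ (n - i) * int (i choose l)"
    using assms binomial_symmetric[of l i] by (auto simp: coeff_one_X_power)
  finally show ?thesis .
qed

definition h_from_f :: "nat \<Rightarrow> (nat \<Rightarrow> int) \<Rightarrow> nat \<Rightarrow> int" where
  "h_from_f n f k = coeff (\<Sum>i\<le>n. smult (f i) ([:-1, 1:] ^ (n - i))) (n - k)"

text \<open>The inverse transformation, from the \<open>h\<close>-vector back to the face
  numbers.\<close>

lemma sum_h_choose:
  assumes "l \<le> n"
  shows "(\<Sum>k\<le>n. h_from_f n f k * int ((n - k) choose (n - l))) = f l"
proof -
  have "(\<Sum>k\<le>n. h_from_f n f k * int ((n - k) choose (n - l)))
      = (\<Sum>i\<le>n. f i * (\<Sum>k\<le>n. coeff ([:-1, 1:] ^ (n - i)) (n - k) * int ((n - k) choose (n - l))))"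
    unfolding h_from_f_def coeff_sum coeff_smult sum_distrib_left sum_distrib_right mult.assoc
    by (rule sum.swap)
  also have "\<dots> = (\<Sum>i\<le>n. if i = l then f i else 0)"
    using assms by (intro sum.cong) (auto simp: sum_coeff_shift)
  finally show ?thesis using assms by simp
qed

text \<open>The same transformation for the reversed \<open>h\<close>-vector. The right side is the
  alternating sum that the Dehn-Sommerville relations evaluate.\<close>

lemma sum_h_choose_reflect:
  assumes "l \<le> n"
  shows "(\<Sum>k\<le>n. h_from_f n f k * int (k choose (n - l)))
    = (\<Sum>i\<le>n. (-1) ^ (n - i) * int (i choose l) * f i)"
proof -
  have "(\<Sum>k\<le>n. h_from_f n f k * int (k choose (n - l)))
      = (\<Sum>i\<le>n. f i * (\<Sum>k\<le>n. coeff ([:-1, 1:] ^ (n - i)) (n - k) * int (k choose (n - l))))"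
    unfolding h_from_f_def coeff_sum coeff_smult sum_distrib_left sum_distrib_right mult.assoc
    by (rule sum.swap)
  also have "\<dots> = (\<Sum>i\<le>n. (-1) ^ (n - i) * int (i choose l) * f i)"
    using assms by (intro sum.cong) (auto simp: sum_coeff_reflect)
  finally show ?thesis .
qed

lemma sum_alternating_choose:
  "0 < j \<Longrightarrow> j \<le> n \<Longrightarrow> (\<Sum>l = 1..n. (-1) ^ l * int (j choose l)) = -1"
proof -
  assume j: "0 < j" "j \<le> n"
  have "(\<Sum>l\<le>n. (-1) ^ l * int (j choose l)) = (\<Sum>l\<le>j. (-1) ^ l * int (j choose l))"
    using j by (intro sum.mono_neutral_right) auto
  also have "\<dots> = 0" using choose_alternating_sum[OF j(1), where 'a = int] by simp
  finally show ?thesis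
    by (simp add: atMost_atLeast0 sum.atLeast_Suc_atMost)
qed

text \<open>Adding the relations with signs \<open>(-1) ^ l\<close> and exchanging the sums turns
  the alternating sum \<open>S\<close> into \<open>- S\<close>; evenness of \<open>n\<close> makes
  the sign on the right of each relation positive.\<close>

lemma dehn_sommerville_euler:
  fixes f :: "nat \<Rightarrow> int"
  assumes "\<And>l. 0 < l \<Longrightarrow> l \<le> n \<Longrightarrow> (\<Sum>j\<le>n. (-1) ^ j * int (j choose l) * f j) = (-1) ^ n * f l"
    and "even n"
  shows "(\<Sum>j = 1..n. (-1) ^ j * f j) = 0"
proof -
  have "(\<Sum>l = 1..n. (-1) ^ l * f l) = (\<Sum>l = 1..n. \<Sum>j\<le>n. (-1) ^ l * ((-1) ^ j * int (j choose l) * f j))"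
    using assms by (simp add: sum_distrib_left[symmetric])
  also have "\<dots> = (\<Sum>j\<le>n. (-1) ^ j * f j * (\<Sum>l = 1..n. (-1) ^ l * int (j choose l)))"
    by (subst sum.swap) (simp add: sum_distrib_left mult_ac)
  also have "\<dots> = (\<Sum>j = 1..n. (-1) ^ j * f j * (\<Sum>l = 1..n. (-1) ^ l * int (j choose l)))"
    by (rule sum.mono_neutral_right) (auto simp: not_less_eq_eq[symmetric] binomial_eq_0)
  also have "\<dots> = (\<Sum>j = 1..n. (-1) ^ j * f j * (-1))"
    by (intro sum.cong refl arg_cong2[where f = "(*)"] sum_alternating_choose) auto
  also have "\<dots> = - (\<Sum>j = 1..n. (-1) ^ j * f j)"
    by (simp only: sum_distrib_right[symmetric] mult_minus1_right sum_negf)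
  finally show ?thesis by simp
qed

subsection \<open>Semi-Eulerian simplicial posets\<close>

text \<open>Induction on the size of the interval: a pair that is not a cover has an element
  strictly between, and both subintervals are smaller.\<close>

lemma graded_poset_rk_less:
  fixes X :: "'a set"
  assumes gr: "graded_poset X le rk z0 z1" and "x \<in> X" "y \<in> X" "lt_on le x y"
  shows "rk x < rk y"
  using assms(2-)
proof (induction "card {z \<in> X. le x z \<and> le z y}" arbitrary: x y rule: less_induct)
  case less
  have "\<forall>x\<in>X. le x x" "\<forall>x\<in>X. \<forall>y\<in>X. le x y \<and> le y x \<longrightarrow> x = y"
    "\<forall>x\<in>X. \<forall>y\<in>X. \<forall>z\<in>X. le x y \<and> le y z \<longrightarrow> le x z"
    and fin: "finite X" and cover: "\<forall>x\<in>X. \<forall>y\<in>X. covers_on X le x y \<longrightarrow> rk y = rk x + 1"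
    using gr unfolding graded_poset_def by - (elim conjE, assumption)+
  then have refl: "\<And>x. x \<in> X \<Longrightarrow> le x x"
    and antisym: "\<And>x y. x \<in> X \<Longrightarrow> y \<in> X \<Longrightarrow> le x y \<Longrightarrow> le y x \<Longrightarrow> x = y"
    and trans: "\<And>x y z. x \<in> X \<Longrightarrow> y \<in> X \<Longrightarrow> z \<in> X \<Longrightarrow> le x y \<Longrightarrow> le y z \<Longrightarrow> le x z"
    by blast+
  show ?case
  proof (cases "covers_on X le x y")
    case True
    then show ?thesis using cover less.prems by simp
  next
    case False
    then obtain z where z: "z \<in> X" "lt_on le x z" "lt_on le z y"
      using less.prems unfolding covers_on_def by blast
    have le: "le x z" "le z y" "le x y" using z less.prems by (simp_all add: lt_on_def)
    have "\<not> le y z" "\<not> le z x" using antisym z less.prems unfolding lt_on_def by metis+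
    then have y: "y \<notin> {w \<in> X. le x w \<and> le w z}" and x: "x \<notin> {w \<in> X. le z w \<and> le w y}"
      by simp_all
    have psubset: "A \<subset> B" if "A \<subseteq> B" "a \<in> B" "a \<notin> A" for A B :: "'a set" and a
      using that by blast
    have "{w \<in> X. le x w \<and> le w z} \<subset> {w \<in> X. le x w \<and> le w y}"
      using trans[OF _ z(1) less.prems(2) _ le(2)] le refl less.prems
      by (intro psubset[OF _ _ y]) auto
    moreover have "{w \<in> X. le z w \<and> le w y} \<subset> {w \<in> X. le x w \<and> le w y}"
      using trans[OF less.prems(1) z(1) _ le(1)] le refl less.prems
      by (intro psubset[OF _ _ x]) auto
    ultimately have "card {w \<in> X. le x w \<and> le w z} < card {w \<in> X. le x w \<and> le w y}"
      "card {w \<in> X. le z w \<and> le w y} < card {w \<in> X. le x w \<and> le w y}"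
      using fin by (simp_all add: psubset_card_mono)
    then have "rk x < rk z" "rk z < rk y"
      using less.hyps less.prems z by blast+
    then show ?thesis by simp
  qed
qed

lemma graded_poset_ranked:
  assumes "graded_poset X le rk z0 z1"
  shows "ranked_poset X le rk z0 z1"
proof -
  have "finite X" "\<forall>x\<in>X. le x x" "\<forall>x\<in>X. \<forall>y\<in>X. le x y \<and> le y x \<longrightarrow> x = y"
    "\<forall>x\<in>X. \<forall>y\<in>X. \<forall>z\<in>X. le x y \<and> le y z \<longrightarrow> le x z"
    "z0 \<in> X" "z1 \<in> X" "\<forall>x\<in>X. le z0 x \<and> le x z1" "rk z0 = 0"
    using assms unfolding graded_poset_def by - (elim conjE, assumption)+
  then show ?thesis
    by unfold_locales (use graded_poset_rk_less[OF assms] in blast)+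
qed

text \<open>\<open>boolean_lower\<close> says nothing about ranks. Removing one element from a set
  corresponds to a cover, so the rank equals the cardinality of the corresponding set, and the count
  becomes one of subsets.\<close>

lemma boolean_lower_rank_below:
  assumes gr: "graded_poset X le rk z0 z1" and x: "x \<in> X" and "boolean_lower X le z0 x"
    and l: "l < rk x"
  shows "ranked_poset.rank_below X le rk l x = rk x choose l"
proof -
  interpret ranked_poset X le rk z0 z1 by (rule graded_poset_ranked[OF gr])
  define I where "I = interval_on X le z0 x"
  obtain A :: "nat set" and f where A: "finite A" and f: "bij_betw f I (Pow A)"
    and iso: "\<And>y z. y \<in> I \<Longrightarrow> z \<in> I \<Longrightarrow> le y z \<longleftrightarrow> f y \<subseteq> f z"
    using assms(3) unfolding boolean_lower_def I_def by blast
  have I: "y \<in> I \<longleftrightarrow> y \<in> X \<and> le y x" for y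
    using bot_le by (auto simp: I_def interval_on_def)
  have inj: "y \<in> I \<Longrightarrow> z \<in> I \<Longrightarrow> f y = f z \<Longrightarrow> y = z" for y z
    using f by (auto simp: bij_betw_def inj_on_def)
  have f_in: "y \<in> I \<Longrightarrow> f y \<subseteq> A" for y
    using f by (auto simp: bij_betw_def)
  have onto: "B \<subseteq> A \<Longrightarrow> \<exists>y\<in>I. f y = B" for B
    using f unfolding bij_betw_def by (metis Pow_iff imageE)
  have rk_card: "rk y = card (f y)" if "y \<in> I" for y
    using that
  proof (induction "card (f y)" arbitrary: y)
    case 0
    have "f y = {}" using 0 f_in A finite_subset by fastforce
    moreover have "z0 \<in> I" using I bot_in bot_le x by blast
    moreover have "f z0 \<subseteq> f y" using iso 0 bot_le I \<open>z0 \<in> I\<close> by blast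
    ultimately have "y = z0" using inj 0 by blast
    then show ?case using 0 rk_bot by simp
  next
    case (Suc k)
    have fin: "finite (f y)" using Suc.hyps(2) card.infinite by fastforce
    obtain a where a: "a \<in> f y" using Suc.hyps(2) by fastforce
    \<comment> \<open>No set lies strictly between \<open>f y - {a}\<close> and \<open>f y\<close>,
      so \<open>w\<close> will be covered by \<open>y\<close>.\<close>
    obtain w where w: "w \<in> I" "f w = f y - {a}"
      using onto[of "f y - {a}"] f_in[OF Suc.prems] by blast
    have "k = card (f w)" using Suc.hyps(2) w a fin by simp
    then have "rk w = k" using Suc.hyps(1)[of w] w(1) by simp
    have lt: "lt_on le w y" using iso w Suc.prems a unfolding lt_on_def by blast
    have "\<not> (lt_on le w z \<and> lt_on le z y)" if z: "z \<in> X" for z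
    proof
      assume *: "lt_on le w z \<and> lt_on le z y"
      then have "z \<in> I" using z I Suc.prems x le_trans unfolding lt_on_def by blast
      then have "f y - {a} \<subseteq> f z" "f z \<subseteq> f y" "f z \<noteq> f w" "f z \<noteq> f y"
        using * iso w Suc.prems inj unfolding lt_on_def by blast+
      then show False using w(2) by blast
    qed
    then have "covers_on X le w y" using lt unfolding covers_on_def by blast
    then have "rk y = rk w + 1" using gr w(1) Suc.prems I unfolding graded_poset_def by blast
    then show ?case using \<open>rk w = k\<close> Suc.hyps(2) by simp
  qed
  have "x \<in> I" using I x le_refl by blast
  moreover obtain y where y: "y \<in> I" "f y = A" using onto by blast
  moreover have "f y \<subseteq> f x" using iso y(1) I \<open>x \<in> I\<close> by blast
  ultimately have "f x = A" using f_in by blast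
  then have rkx: "rk x = card A" using rk_card \<open>x \<in> I\<close> by simp
  have eq: "{y \<in> X. lt_on le y x \<and> rk y = l} = {y \<in> I. card (f y) = l}"
    using I rk_card l by (auto simp: lt_on_def)
  have "bij_betw f {y \<in> I. card (f y) = l} {B. B \<subseteq> A \<and> card B = l}"
    unfolding bij_betw_def
  proof
    show "inj_on f {y \<in> I. card (f y) = l}" using inj by (auto simp: inj_on_def)
    show "f ` {y \<in> I. card (f y) = l} = {B. B \<subseteq> A \<and> card B = l}"
      using f_in onto by (auto simp: image_iff) metis
  qed
  then have "card {y \<in> I. card (f y) = l} = card A choose l"
    using n_subsets[OF A] bij_betw_same_card by fastforce
  then show ?thesis by (simp add: rank_below_def eq rkx)
qed

section \<open>Dehn-Sommerville relations and the polynomial of \<open>P\<close>\<close>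

context
  fixes X :: "'a set" and le rk z0 z1 m
  assumes graded: "graded_poset X le rk z0 z1" and top_rk: "rk z1 = Suc (Suc m)"
    and semi: "semi_eulerian X le rk z0 z1" and simplicial: "simplicial_poset X le rk z0 z1"
begin

interpretation ranked_poset X le rk z0 z1
  by (rule graded_poset_ranked[OF graded])

lemma simplicial_rank_below:
  assumes "y \<in> X" "y \<noteq> z1" "l < rk y"
  shows "rank_below l y = rk y choose l"
  using boolean_lower_rank_below[OF graded assms(1) _ assms(3)] simplicial assms
  unfolding simplicial_poset_def by blast

lemma simplicial_rank_le:
  assumes "y \<in> X" "y \<noteq> z1"
  shows "card {x \<in> X. le x y \<and> rk x = l} = rk y choose l"
proof (cases "l < rk y")
  case True
  then have "{x \<in> X. le x y \<and> rk x = l} = {x \<in> X. lt_on le x y \<and> rk x = l}"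
    by (auto simp: lt_on_def)
  then show ?thesis using simplicial_rank_below[OF assms True] by (simp add: rank_below_def)
next
  case False
  then have "{x \<in> X. le x y \<and> rk x = l} = (if l = rk y then {y} else {})"
  proof -
    have "x = y" if "x \<in> X" "le x y" "rk x = rk y" for x
      using rk_less[OF that(1) assms(1)] that by (auto simp: lt_on_def)
    moreover have "rk x \<le> rk y" if "x \<in> X" "le x y" for x
      using rk_mono that assms(1) by blast
    ultimately show ?thesis
      using False le_refl[OF assms(1)] assms(1) by (auto simp: not_less intro: antisym)
  qed
  then show ?thesis using False by simp
qed

lemma rk_le_non_top: "x \<in> X \<Longrightarrow> x \<noteq> z1 \<Longrightarrow> rk x \<le> Suc m"
  using rk_less[OF _ top_in] le_top top_rk by (fastforce simp: lt_on_def)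

lemma eulerian_upper_interval:
  assumes "s \<in> X" "s \<noteq> z0" "s \<noteq> z1"
  shows "(\<Sum>y\<in>{y \<in> X. le s y}. (-1) ^ rk y) = (0 :: int)"
proof -
  have I: "interval_on X le s z1 = {y \<in> X. le s y}"
    using le_top by (auto simp: interval_on_def)
  have fin: "finite {y \<in> X. le s y}" using finite_carrier by simp
  have "card {x \<in> interval_on X le s z1. odd (rk x)}
      = card {x \<in> interval_on X le s z1. even (rk x)}"
    using semi assms top_in le_top unfolding semi_eulerian_def lt_on_def by blast
  then have card: "card {y \<in> X. le s y \<and> odd (rk y)} = card {y \<in> X. le s y \<and> even (rk y)}"
    by (simp add: I conj_assoc)
  have "(\<Sum>y\<in>{y \<in> X. le s y}. (-1) ^ rk y :: int)
      = (\<Sum>y\<in>{y \<in> X. le s y}. if even (rk y) then 1 else -1)"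
    by (intro sum.cong) auto
  also have "\<dots> = int (card {y \<in> X. le s y \<and> even (rk y)}) - int (card {y \<in> X. le s y \<and> odd (rk y)})"
    using fin by (simp add: sum.If_cases Int_def conj_assoc)
  finally show ?thesis using card by simp
qed

text \<open>Add the Euler relations of the intervals from \<open>s\<close> to \<open>z1\<close> over
  all \<open>s\<close> of rank \<open>l\<close> and count pairs by their upper element, which has
  \<open>rk y choose l\<close> elements of rank \<open>l\<close> below it unless it is
  \<open>z1\<close>. The term of \<open>z1\<close> moves to the other side and becomes the right
  side; \<open>0 < l\<close> keeps away from the whole poset.\<close>

lemma simplicial_dehn_sommerville:
  assumes l: "0 < l" "l \<le> Suc m"
  shows "(\<Sum>j\<le>Suc m. (-1) ^ j * int (j choose l) * int (rank_num j)) = (-1) ^ Suc m * int (rank_num l)"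
proof -
  let ?L = "{s \<in> X. rk s = l}"
  have "(0 :: int) = (\<Sum>s\<in>?L. \<Sum>y\<in>{y \<in> X. le s y}. (-1) ^ rk y)"
    using l top_rk rk_bot by (intro sum.neutral[symmetric] ballI eulerian_upper_interval) auto
  also have "\<dots> = (\<Sum>s\<in>?L. \<Sum>y\<in>X. if le s y then (-1) ^ rk y else 0)"
    using finite_carrier by (simp add: sum.If_cases Int_def)
  also have "\<dots> = (\<Sum>y\<in>X. \<Sum>s\<in>?L. if le s y then (-1) ^ rk y else 0)"
    by (rule sum.swap)
  also have "\<dots> = (\<Sum>y\<in>X. (-1) ^ rk y * int (card {s \<in> X. le s y \<and> rk s = l}))"
    using finite_carrier by (simp add: sum.If_cases Int_def conj_ac mult.commute)
  also have "\<dots> = (-1) ^ rk z1 * int (card {s \<in> X. le s z1 \<and> rk s = l})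
      + (\<Sum>y\<in>X - {z1}. (-1) ^ rk y * int (card {s \<in> X. le s y \<and> rk s = l}))"
    by (rule sum.remove[OF finite_carrier top_in])
  also have "{s \<in> X. le s z1 \<and> rk s = l} = ?L"
    using le_top by auto
  also have "(\<Sum>y\<in>X - {z1}. (-1) ^ rk y * int (card {s \<in> X. le s y \<and> rk s = l}))
      = (\<Sum>y\<in>X - {z1}. (-1) ^ rk y * int (rk y choose l))"
    by (intro sum.cong) (auto simp: simplicial_rank_le)
  also have "\<dots> = (\<Sum>j\<le>Suc m. \<Sum>y\<in>{y \<in> X - {z1}. rk y = j}. (-1) ^ rk y * int (rk y choose l))"
    using finite_carrier rk_le_non_top by (intro sum.group[symmetric]) auto
  also have "\<dots> = (\<Sum>j\<le>Suc m. (-1) ^ j * int (j choose l) * int (rank_num j))"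
  proof (rule sum.cong)
    fix j assume "j \<in> {..Suc m}"
    then have "{y \<in> X - {z1}. rk y = j} = {y \<in> X. rk y = j}" using top_rk by auto
    then show "(\<Sum>y\<in>{y \<in> X - {z1}. rk y = j}. (-1) ^ rk y * int (rk y choose l))
        = (-1) ^ j * int (j choose l) * int (rank_num j)"
      by (simp add: rank_num_def)
  qed simp
  finally show ?thesis using top_rk by (simp add: rank_num_def)
qed

lemma simplicial_h_vec: "h_vec X le rk z0 z1 k = h_from_f (Suc m) (\<lambda>i. int (rank_num i)) k"
proof -
  have "face_num X le rk z0 i = rank_num i" if "i \<le> Suc m" for i
  proof -
    have "{x \<in> X. boolean_lower X le z0 x \<and> rk x = i} = {x \<in> X. rk x = i}"
      using that simplicial top_rk unfolding simplicial_poset_def by auto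
    then show ?thesis by (simp add: face_num_def rank_num_def)
  qed
  then show ?thesis
    by (simp add: h_vec_def h_from_f_def pn_def top_rk atMost_atLeast0)
qed

text \<open>The binomial sums in the criterion are transforms of the \<open>h\<close>-vector and of
  its reversal. For \<open>l > 0\<close> the Dehn-Sommerville relations evaluate the latter; for
  \<open>l = 0\<close> the Euler correction compensates.\<close>

lemma simplicial_chi'_sub:
  "chi'_sub X le rk z0 z1 = (\<lambda>v. \<Sum>i\<le>m. h_vec X le rk z0 z1 i * check_poly m i v)"
proof (rule chi'_sub_eq_check_poly_sum[OF top_rk])
  let ?f = "\<lambda>i. int (rank_num i)" and ?h = "h_vec X le rk z0 z1"
  have h: "(\<Sum>k\<le>Suc m. ?h k * int ((Suc m - k) choose (Suc m - l))) = ?f l"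
    "(\<Sum>k\<le>Suc m. ?h k * int (k choose (Suc m - l)))
      = (\<Sum>i\<le>Suc m. (-1) ^ (Suc m - i) * int (i choose l) * ?f i)"
    if "l \<le> Suc m" for l
    unfolding simplicial_h_vec by (rule sum_h_choose[OF that], rule sum_h_choose_reflect[OF that])
  have total: "(\<Sum>k\<le>Suc m. ?h k) = ?f (Suc m)"
    using h(1)[of "Suc m"] by simp
  have sign: "(-1 :: int) ^ (Suc m - i) = (-1) ^ Suc m * (-1) ^ i" if "i \<le> Suc m" for i
    using that by (auto simp: minus_one_power_iff simp del: power_Suc)
  have upper: "(\<Sum>i\<le>m. ?h i * (int (Suc m choose l) + int ((Suc m - i) choose (Suc m - l))
          - int (i choose (Suc m - l))))
      = int (Suc m choose l) * ?f (Suc m) + ?f l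
        - (\<Sum>i\<le>Suc m. (-1) ^ (Suc m - i) * int (i choose l) * ?f i)" if "l \<le> m" for l
  proof -
    \<comment> \<open>The term at \<open>i = Suc m\<close> is zero because the first and last
      binomials cancel, so the sum may be extended to the full range of the
      \<open>h\<close>-vector.\<close>
    have "(\<Sum>i\<le>m. ?h i * (int (Suc m choose l) + int ((Suc m - i) choose (Suc m - l))
          - int (i choose (Suc m - l))))
        = (\<Sum>i\<le>Suc m. ?h i * (int (Suc m choose l) + int ((Suc m - i) choose (Suc m - l))
          - int (i choose (Suc m - l))))"
      using that binomial_symmetric[of l "Suc m"] by (simp add: Suc_diff_le)
    also have "\<dots> = int (Suc m choose l) * (\<Sum>i\<le>Suc m. ?h i)
        + (\<Sum>i\<le>Suc m. ?h i * int ((Suc m - i) choose (Suc m - l)))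
        - (\<Sum>i\<le>Suc m. ?h i * int (i choose (Suc m - l)))"
      by (simp only: sum_distrib_left sum.distrib[symmetric] sum_subtractf[symmetric] algebra_simps)
    finally show ?thesis using that by (simp only: total h le_SucI)
  qed
  have signed_sum: "(\<Sum>i\<le>Suc m. (-1) ^ (Suc m - i) * int (i choose l) * ?f i)
      = (-1) ^ Suc m * (\<Sum>i\<le>Suc m. (-1) ^ i * int (i choose l) * ?f i)" for l
    unfolding sum_distrib_left by (intro sum.cong refl) (simp only: sign atMost_iff mult.assoc)
  {
    fix y l assume "y \<in> X" "0 < rk y" "rk y \<le> m" "l < rk y"
    then show "rank_below l y = rk y choose l"
      using top_rk by (intro simplicial_rank_below) auto
  next
    fix l assume "l \<le> m"
    then show "?f l = (\<Sum>i\<le>m. ?h i * int ((Suc m - i) choose (Suc m - l)))"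
      using h(1)[of l] by (simp add: Suc_diff_le)
  next
    fix l assume l: "0 < l" "l \<le> m"
    have "(\<Sum>y\<in>{y \<in> X. rk y = Suc m}. int (rank_below l y)) = int (Suc m choose l) * ?f (Suc m)"
    proof -
      have "(\<Sum>y\<in>{y \<in> X. rk y = Suc m}. int (rank_below l y))
          = (\<Sum>y\<in>{y \<in> X. rk y = Suc m}. int (Suc m choose l))"
      proof (intro sum.cong refl)
        fix y assume "y \<in> {y \<in> X. rk y = Suc m}"
        then have "y \<in> X" "rk y = Suc m" "y \<noteq> z1" using top_rk by auto
        then show "int (rank_below l y) = int (Suc m choose l)"
          using simplicial_rank_below[of y l] l by simp
      qed
      then show ?thesis by (simp add: rank_num_def)
    qed
    \<comment> \<open>By this the last two terms of \<open>upper\<close> cancel, leaving only the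
      incidences inside Boolean facets.\<close>
    moreover have "(\<Sum>i\<le>Suc m. (-1) ^ (Suc m - i) * int (i choose l) * ?f i) = ?f l"
      unfolding signed_sum simplicial_dehn_sommerville[OF l(1) le_SucI[OF l(2)]] by simp
    ultimately show "(\<Sum>y\<in>{y \<in> X. rk y = Suc m}. int (rank_below l y))
        = (\<Sum>i\<le>m. ?h i * (int (Suc m choose l) + int ((Suc m - i) choose (Suc m - l))
          - int (i choose (Suc m - l))))"
      unfolding upper[OF l(2)] by simp
  next
    have "{x \<in> X. rk x = 0} = {z0}" using rk_eq_0 bot_in by auto
    then have f0: "?f 0 = 1" by (simp add: rank_num_def)
    let ?S = "\<Sum>j = 1..Suc m. (-1) ^ j * ?f j"
    have "euler_chi X le rk z0 z1 = (\<Sum>j = 1..Suc m. - ((-1) ^ j * ?f j))"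
      unfolding euler_chi_eq by (rule sum.cong) (auto simp: top_rk power_eq_if)
    then have chi: "euler_chi X le rk z0 z1 = - ?S" by (simp only: sum_negf)
    have sum0: "(\<Sum>i\<le>Suc m. (-1) ^ i * int (i choose 0) * ?f i) = 1 + ?S"
      by (simp add: atMost_atLeast0 sum.atLeast_Suc_atMost f0)
    have r: "(\<Sum>i\<le>m. ?h i * (1 + int ((Suc m - i) choose (Suc m)) - int (i choose (Suc m))))
        = ?f (Suc m) + 1 - (-1) ^ Suc m * (1 + ?S)"
      using upper[of 0, unfolded signed_sum sum0]
      by (simp add: f0 del: sum.atMost_Suc sum.cl_ivl_Suc power_Suc)
    \<comment> \<open>The two sides of the facet condition differ by
      \<open>(1 + (-1) ^ Suc m) * ?S\<close>, which vanishes by itself when \<open>Suc m\<close> is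
      odd.\<close>
    have "?S = 0" if "even (Suc m)"
      by (rule dehn_sommerville_euler[OF simplicial_dehn_sommerville that])
    then show "?f (Suc m) + chi_sphere (Suc m) - euler_chi X le rk z0 z1
        = (\<Sum>i\<le>m. ?h i * (1 + int ((Suc m - i) choose (Suc m)) - int (i choose (Suc m))))"
      unfolding r chi chi_sphere_def by (cases "even (Suc m)") simp_all
  }
qed

end

subsection \<open>Semisuspensions of simplicial balls\<close>

lemma card_between_subsets:
  assumes "finite B" "A \<subseteq> B" "l \<le> card B"
  shows "card {F. A \<subseteq> F \<and> F \<subseteq> B \<and> card F = l} = (card B - card A) choose (card B - l)"
proof -
  have finA: "finite A" using assms finite_subset by blast
  have fin: "F \<subseteq> B \<Longrightarrow> finite F" for F using assms(1) finite_subset by blast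
  have "bij_betw (\<lambda>F. B - F) {F. A \<subseteq> F \<and> F \<subseteq> B \<and> card F = l}
      {G. G \<subseteq> B - A \<and> card G = card B - l}"
  proof (rule bij_betw_byWitness[where f' = "\<lambda>G. B - G"])
    show "(\<lambda>F. B - F) ` {F. A \<subseteq> F \<and> F \<subseteq> B \<and> card F = l}
        \<subseteq> {G. G \<subseteq> B - A \<and> card G = card B - l}"
      using fin by (auto simp: card_Diff_subset)
    show "(\<lambda>G. B - G) ` {G. G \<subseteq> B - A \<and> card G = card B - l}
        \<subseteq> {F. A \<subseteq> F \<and> F \<subseteq> B \<and> card F = l}"
    proof clarify
      fix G assume G: "G \<subseteq> B - A" "card G = card B - l"
      then have "G \<subseteq> B" by blast
      then have "card (B - G) = l" using fin[of G] G(2) assms(3) by (simp add: card_Diff_subset)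
      then show "A \<subseteq> B - G \<and> B - G \<subseteq> B \<and> card (B - G) = l" using G(1) assms(2) by blast
    qed
  qed blast+
  then have "card {F. A \<subseteq> F \<and> F \<subseteq> B \<and> card F = l} = card (B - A) choose (card B - l)"
    using bij_betw_same_card n_subsets[of "B - A" "card B - l"] assms(1) by fastforce
  then show ?thesis using assms(2) finA by (simp add: card_Diff_subset)
qed

lemma subset_sigma: "F \<subseteq> sigma n j \<longleftrightarrow> F \<subseteq> {0..n} \<and> j \<notin> F"
  by (auto simp: sigma_def)

lemma card_sigma: "j \<le> n \<Longrightarrow> card (sigma n j) = n"
  by (simp add: sigma_def)

text \<open>A ridge omits exactly two vertices \<open>i\<close> and \<open>j\<close> and lies in the
  facets \<open>sigma n i\<close> and \<open>sigma n j\<close> only. It is in exactly one facet of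
  the ball iff one of \<open>i\<close>, \<open>j\<close> is at most \<open>k\<close> and the other
  is greater.\<close>

lemma bdry_faces_eq:
  assumes "1 \<le> n" "k < n"
  shows "bdry_faces n k = {F. F \<subseteq> {0..n} \<and> (\<exists>i\<le>k. i \<notin> F) \<and> (\<exists>j\<in>{k<..n}. j \<notin> F)}"
proof (intro equalityI subsetI)
  fix F assume "F \<in> bdry_faces n k"
  then obtain R where R: "F \<subseteq> R" "R \<subseteq> {0..n}" "card R = n - 1"
    and one: "card {j. j \<le> k \<and> R \<subseteq> sigma n j} = 1"
    unfolding bdry_faces_def by blast
  have finR: "finite R" using R(2) finite_subset by blast
  obtain i where i: "{j. j \<le> k \<and> R \<subseteq> sigma n j} = {i}"
    using one by (auto simp: card_1_singleton_iff)
  then have i': "i \<le> k" "i \<notin> R" by (auto simp: subset_sigma)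
  have "card ({0..n} - R) = 2"
    using R finR assms(1) by (simp add: card_Diff_subset)
  moreover have "i \<in> {0..n} - R" using i' assms(2) by simp
  ultimately obtain j where j: "j \<in> {0..n} - R" "j \<noteq> i"
    by (metis card_2_iff insertI1 insert_commute)
  then have "\<not> j \<le> k" using i R(2) by (auto simp: subset_sigma)
  then have "j \<in> {k<..n}" using j by simp
  then show "F \<in> {F. F \<subseteq> {0..n} \<and> (\<exists>i\<le>k. i \<notin> F) \<and> (\<exists>j\<in>{k<..n}. j \<notin> F)}"
    using R(1,2) i' j by blast
next
  fix F assume "F \<in> {F. F \<subseteq> {0..n} \<and> (\<exists>i\<le>k. i \<notin> F) \<and> (\<exists>j\<in>{k<..n}. j \<notin> F)}"
  then obtain i j where ij: "F \<subseteq> {0..n}" "i \<le> k" "i \<notin> F" "k < j" "j \<le> n" "j \<notin> F" by auto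
  let ?R = "{0..n} - {i, j}"
  have "card ?R = n - 1" using ij by (simp add: card_Diff_subset)
  moreover have "{a. a \<le> k \<and> ?R \<subseteq> sigma n a} = {i}"
    using ij by (auto simp: subset_sigma)
  ultimately show "F \<in> bdry_faces n k"
    unfolding bdry_faces_def using ij by (intro CollectI exI[of _ ?R]) auto
qed

lemma finite_gamma_faces: "finite (gamma_faces n k)"
  by (rule finite_subset[of _ "Pow {0..n}"]) (auto simp: gamma_faces_def subset_sigma)

lemma bdry_subset_gamma: "1 \<le> n \<Longrightarrow> k < n \<Longrightarrow> bdry_faces n k \<subseteq> gamma_faces n k"
  by (auto simp: bdry_faces_eq gamma_faces_def subset_sigma)

text \<open>The facets are added in shelling order: the faces new in \<open>sigma n (Suc k)\<close>
  are those containing \<open>{0..k}\<close>. Each facet up to \<open>k\<close> thus adds 1 to one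
  entry of the \<open>h\<close>-vector.\<close>

lemma card_gamma_faces:
  assumes "k < n" "l \<le> n"
  shows "card {F \<in> gamma_faces n k. card F = l} = (\<Sum>i\<le>k. (n - i) choose (n - l))"
  using assms(1)
proof (induction k)
  case 0
  have "{F \<in> gamma_faces n 0. card F = l} = {F. {} \<subseteq> F \<and> F \<subseteq> sigma n 0 \<and> card F = l}"
    by (auto simp: gamma_faces_def)
  also have "card \<dots> = n choose (n - l)"
    using card_between_subsets[of "sigma n 0" "{}" l] assms(2)
    by (simp add: card_sigma) (simp add: sigma_def)
  finally show ?case by simp
next
  case (Suc k)
  let ?N = "{F. {0..k} \<subseteq> F \<and> F \<subseteq> sigma n (Suc k) \<and> card F = l}"
  have "{F \<in> gamma_faces n (Suc k). card F = l} = {F \<in> gamma_faces n k. card F = l} \<union> ?N"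
    by (auto simp: gamma_faces_def subset_sigma le_Suc_eq)
  moreover have "{F \<in> gamma_faces n k. card F = l} \<inter> ?N = {}"
    by (auto simp: gamma_faces_def subset_sigma)
  moreover have "card ?N = (n - Suc k) choose (n - l)"
    using card_between_subsets[of "sigma n (Suc k)" "{0..k}" l] assms(2) Suc.prems
    by (simp add: card_sigma subset_sigma) (simp add: sigma_def)
  moreover have "finite ?N" by (rule finite_subset[of _ "Pow {0..n}"]) (auto simp: sigma_def)
  ultimately show ?case
    using Suc finite_gamma_faces[of n k] by (simp add: card_Un_disjoint)
qed

text \<open>The faces of the ball outside the boundary are those containing all vertices above
  \<open>k\<close>. There are \<open>Suc k choose Suc (n - l)\<close> of them, a binomial that
  splits into the subtracted sum.\<close>

lemma card_bdry_faces:
  assumes "k < n" "l \<le> n"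
  shows "int (card {F \<in> bdry_faces n k. card F = l})
    = (\<Sum>i\<le>k. int ((n - i) choose (n - l)) - int (i choose (n - l)))"
proof -
  let ?N = "{F. {k<..n} \<subseteq> F \<and> F \<subseteq> {0..n} \<and> card F = l}"
  let ?B = "{F \<in> bdry_faces n k. card F = l}"
  have "1 \<le> n" using assms by simp
  \<comment> \<open>Since \<open>l \<le> n\<close>, such a set omits some vertex, necessarily one up
    to \<open>k\<close>, and so is a face of the ball.\<close>
  have "\<exists>i\<le>k. i \<notin> F" if "{k<..n} \<subseteq> F" "F \<subseteq> {0..n}" "card F = l" for F
  proof (rule ccontr)
    assume "\<not> (\<exists>i\<le>k. i \<notin> F)"
    moreover have "{0..n} = {..k} \<union> {k<..n}" using assms(1) by auto
    ultimately have "F = {0..n}" using that(1,2) by fastforce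
    then show False using that(3) assms(2) by simp
  qed
  then have "{F \<in> gamma_faces n k. card F = l} = ?B \<union> ?N"
    using bdry_subset_gamma[OF \<open>1 \<le> n\<close> assms(1)]
    by (auto simp: bdry_faces_eq[OF \<open>1 \<le> n\<close> assms(1)] gamma_faces_def subset_sigma)
  moreover have "?B \<inter> ?N = {}"
    by (auto simp: bdry_faces_eq[OF \<open>1 \<le> n\<close> assms(1)])
  moreover have "finite ?B"
    using finite_gamma_faces bdry_subset_gamma[OF \<open>1 \<le> n\<close> assms(1)] finite_subset by fastforce
  moreover have "finite ?N" by (rule finite_subset[of _ "Pow {0..n}"]) auto
  ultimately have "card {F \<in> gamma_faces n k. card F = l} = card ?B + card ?N"
    by (simp add: card_Un_disjoint)
  moreover have "card ?N = Suc k choose Suc (n - l)"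
  proof -
    have "{k<..n} \<subseteq> {0..n}" by auto
    then show ?thesis
      using card_between_subsets[of "{0..n}" "{k<..n}" l] assms by (simp add: Suc_diff_le)
  qed
  moreover have "Suc k choose Suc (n - l) = (\<Sum>i\<le>k. i choose (n - l))"
    using sum_choose_upper[of "n - l" k] by simp
  ultimately have "card ?B + (\<Sum>i\<le>k. i choose (n - l)) = (\<Sum>i\<le>k. (n - i) choose (n - l))"
    using card_gamma_faces[OF assms] by simp
  then have "int (card ?B) + int (\<Sum>i\<le>k. i choose (n - l)) = int (\<Sum>i\<le>k. (n - i) choose (n - l))"
    by (simp only: of_nat_add[symmetric])
  then show ?thesis by (simp add: sum_subtractf)
qed

section \<open>The polynomial of the semisuspension\<close>

lemma lam_ranked:
  assumes n: "1 \<le> n" "k < n"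
  shows "ranked_poset (lam_carrier n k) (lam_le n k) (lam_rk n) (Face {}) Top"
proof
  have down: "F \<in> bdry_faces n k" if "F \<subseteq> G" "G \<in> bdry_faces n k" for F G
    using that unfolding bdry_faces_def by blast
  have card_bdry: "card F < n" if "F \<in> bdry_faces n k" for F
  proof -
    obtain R where "F \<subseteq> R" "R \<subseteq> {0..n}" "card R = n - 1"
      using \<open>F \<in> bdry_faces n k\<close> unfolding bdry_faces_def by blast
    then have "card F \<le> n - 1" using card_mono[of R F] finite_subset[of R "{0..n}"] by simp
    then show ?thesis using n by simp
  qed
  have gamma: "finite F \<and> card F \<le> n" if F: "F \<in> gamma_faces n k" for F
  proof -
    obtain j where j: "j \<le> k" "F \<subseteq> sigma n j" using F unfolding gamma_faces_def by blast
    then show ?thesis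
      using n card_sigma[of j n] card_mono[of "sigma n j" F] finite_subset[of F "sigma n j"]
      by (simp add: sigma_def)
  qed
  have top_cases: "lam_le n k Top y \<Longrightarrow> y = Top" for y by (cases y) auto
  show "finite (lam_carrier n k)" by (simp add: lam_carrier_def finite_gamma_faces)
  show "Face {} \<in> lam_carrier n k" "Top \<in> lam_carrier n k"
    by (auto simp: lam_carrier_def gamma_faces_def)
  show "lam_rk n (Face {}) = 0" by simp
  have empty: "{} \<in> bdry_faces n k" using n by (auto simp: bdry_faces_eq)
  fix x y z
  assume x: "x \<in> lam_carrier n k"
  show "lam_le n k x x" by (cases x) auto
  show "lam_le n k (Face {}) x" using empty by (cases x) auto
  show "lam_le n k x Top" by (cases x) auto
  assume y: "y \<in> lam_carrier n k"
  show "lam_le n k x y \<Longrightarrow> lam_le n k y x \<Longrightarrow> x = y" by (cases x; cases y) auto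
  have "card F < card G" if "G \<in> gamma_faces n k" "F \<subseteq> G" "F \<noteq> G" for F G
    using that gamma[of G] by (intro psubset_card_mono) auto
  then show "lt_on (lam_le n k) x y \<Longrightarrow> lam_rk n x < lam_rk n y"
    using x y gamma card_bdry
    by (cases x; cases y) (auto simp: lt_on_def lam_carrier_def le_imp_less_Suc)
  show "lam_le n k x y \<Longrightarrow> lam_le n k y z \<Longrightarrow> lam_le n k x z"
    by (cases x; cases y; cases z; simp) (erule (1) subset_trans down)+
qed

text \<open>The criterion holds with coefficients 1 at the indices up to \<open>k\<close>, the
  \<open>h\<close>-vector of the ball. The incidences below \<open>Tau\<close> are the boundary
  faces, whose count supplies the terms that come from the Dehn-Sommerville relations in the case of
  \<open>P\<close>.\<close>

lemma lam_chi'_sub: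
  assumes k: "k \<le> m"
  shows "chi'_sub (lam_carrier (Suc m) k) (lam_le (Suc m) k) (lam_rk (Suc m)) (Face {}) Top
    = (\<lambda>v. \<Sum>i\<le>k. check_poly m i v)"
proof -
  let ?n = "Suc m" and ?X = "lam_carrier (Suc m) k"
  have n: "1 \<le> ?n" "k < ?n" using k by auto
  interpret ranked_poset ?X "lam_le ?n k" "lam_rk ?n" "Face {}" Top
    by (rule lam_ranked[OF n])
  have inj: "inj_on Face A" for A by (simp add: inj_on_def)
  have down: "G \<in> gamma_faces ?n k" if "F \<in> gamma_faces ?n k" "G \<subseteq> F" for F G
    using that unfolding gamma_faces_def by blast
  have below_face: "rank_below l (Face F) = card F choose l"
    if F: "F \<in> gamma_faces ?n k" and l: "l < card F" for F l
  proof -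
    have "{y \<in> ?X. lt_on (lam_le ?n k) y (Face F) \<and> lam_rk ?n y = l} = Face ` {G. G \<subseteq> F \<and> card G = l}"
    proof (intro equalityI subsetI)
      fix y assume "y \<in> {y \<in> ?X. lt_on (lam_le ?n k) y (Face F) \<and> lam_rk ?n y = l}"
      then show "y \<in> Face ` {G. G \<subseteq> F \<and> card G = l}" by (cases y) (auto simp: lt_on_def)
    qed (use F l down in \<open>auto simp: lt_on_def lam_carrier_def\<close>)
    moreover have "finite F" using l card.infinite by fastforce
    ultimately show ?thesis by (simp add: rank_below_def card_image[OF inj] n_subsets)
  qed
  have below_tau: "rank_below l Tau = card {F \<in> bdry_faces ?n k. card F = l}" if "l < ?n" for l
  proof -
    have "{y \<in> ?X. lt_on (lam_le ?n k) y Tau \<and> lam_rk ?n y = l} = Face ` {F \<in> bdry_faces ?n k. card F = l}"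
    proof (intro equalityI subsetI)
      fix y assume "y \<in> {y \<in> ?X. lt_on (lam_le ?n k) y Tau \<and> lam_rk ?n y = l}"
      then show "y \<in> Face ` {F \<in> bdry_faces ?n k. card F = l}" by (cases y) (auto simp: lt_on_def)
    qed (use bdry_subset_gamma[OF n] in \<open>auto simp: lt_on_def lam_carrier_def\<close>)
    then show ?thesis by (simp add: rank_below_def card_image[OF inj])
  qed
  have rank: "{y \<in> ?X. lam_rk ?n y = l}
      = (if l = ?n then {Tau} else {}) \<union> Face ` {F \<in> gamma_faces ?n k. card F = l}" if "l \<le> ?n" for l
  proof (rule set_eqI)
    fix y
    show "y \<in> {y \<in> ?X. lam_rk ?n y = l}
        \<longleftrightarrow> y \<in> (if l = ?n then {Tau} else {}) \<union> Face ` {F \<in> gamma_faces ?n k. card F = l}"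
      using that by (cases y) (auto simp: lam_carrier_def)
  qed
  have tau: "Tau \<notin> Face ` A" for A by blast
  have fin: "finite {F \<in> gamma_faces ?n k. P F}" for P using finite_gamma_faces by simp
  have num: "rank_num l = (if l = ?n then 1 else 0) + (\<Sum>i\<le>k. (?n - i) choose (?n - l))"
    if "l \<le> ?n" for l
    unfolding rank_num_def rank[OF that] card_gamma_faces[OF n(2) that, symmetric]
    using tau fin by (simp add: card_image[OF inj])
  have diag: "(\<Sum>i\<le>k. int ((?n - i) choose ?n)) = 1"
  proof -
    have "(\<Sum>i\<le>k. int ((?n - i) choose ?n)) = (\<Sum>i\<le>k. if i = 0 then 1 else 0)"
      by (intro sum.cong) (auto simp: binomial_eq_0)
    then show ?thesis by simp
  qed
  \<comment> \<open>The factor 1 only brings the sum into the shape of the criterion.\<close>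
  have "(\<lambda>v. \<Sum>i\<le>k. check_poly m i v) = (\<lambda>v. \<Sum>i\<le>k. 1 * check_poly m i v)" by simp
  moreover have "chi'_sub ?X (lam_le ?n k) (lam_rk ?n) (Face {}) Top
      = (\<lambda>v. \<Sum>i\<le>k. 1 * check_poly m i v)"
  proof (rule chi'_sub_eq_check_poly_sum)
    show "lam_rk ?n Top = Suc (Suc m)" by simp
  next
    fix y l assume y: "y \<in> ?X" "lam_rk ?n y \<le> m" "l < lam_rk ?n y"
    then obtain F where "y = Face F" "F \<in> gamma_faces ?n k" by (auto simp: lam_carrier_def)
    then show "rank_below l y = lam_rk ?n y choose l" using y(3) below_face by simp
  next
    fix l assume "l \<le> m"
    then show "int (rank_num l) = (\<Sum>i\<le>k. 1 * int ((?n - i) choose (?n - l)))"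
      using num[of l] by simp
  next
    fix l assume l: "0 < l" "l \<le> m"
    have "(\<Sum>y\<in>{y \<in> ?X. lam_rk ?n y = ?n}. int (rank_below l y))
        = int (rank_below l Tau) + (\<Sum>F\<in>{F \<in> gamma_faces ?n k. card F = ?n}. int (rank_below l (Face F)))"
      unfolding rank[OF order_refl] using tau fin by (simp add: sum.reindex[OF inj])
    also have "(\<Sum>F\<in>{F \<in> gamma_faces ?n k. card F = ?n}. int (rank_below l (Face F)))
        = (\<Sum>F\<in>{F \<in> gamma_faces ?n k. card F = ?n}. int (?n choose l))"
      using below_face l by (intro sum.cong) auto
    also have "\<dots> = int (Suc k) * int (?n choose l)"
      using card_gamma_faces[OF n(2) order_refl] by simp
    also have "int (rank_below l Tau)
        = (\<Sum>i\<le>k. int ((?n - i) choose (?n - l)) - int (i choose (?n - l)))"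
      using l card_bdry_faces[OF n(2), of l] below_tau[of l] by simp
    finally show "(\<Sum>y\<in>{y \<in> ?X. lam_rk ?n y = ?n}. int (rank_below l y))
        = (\<Sum>i\<le>k. 1 * (int (?n choose l) + int ((?n - i) choose (?n - l)) - int (i choose (?n - l))))"
      by (simp add: sum.distrib sum_subtractf)
  next
    \<comment> \<open>The Euler correction is zero. The faces of the ball, including the empty one,
      have alternating sum 0 because each \<open>i\<close> contributes a full alternating row of
      binomials with \<open>?n - i > 0\<close>; the cell \<open>Tau\<close> adds the remaining
      sign.\<close>
    have chi: "euler_chi ?X (lam_le ?n k) (lam_rk ?n) (Face {}) Top = chi_sphere ?n"
    proof -
      let ?g = "\<lambda>j. \<Sum>i\<le>k. int ((?n - i) choose (?n - j))"
      have "(\<Sum>j\<le>?n. (-1) ^ j * ?g j) = (\<Sum>j\<le>?n. (-1) ^ (?n - j) * (\<Sum>i\<le>k. int ((?n - i) choose j)))"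
        by (rule sum.reindex_bij_witness[of _ "\<lambda>j. ?n - j" "\<lambda>j. ?n - j"]) auto
      also have "\<dots> = (-1) ^ ?n * (\<Sum>j\<le>?n. \<Sum>i\<le>k. (-1) ^ j * int ((?n - i) choose j))"
        unfolding sum_distrib_left by (intro sum.cong) (auto simp: minus_one_power_iff simp del: power_Suc)
      also have "(\<Sum>j\<le>?n. \<Sum>i\<le>k. (-1) ^ j * int ((?n - i) choose j))
          = (\<Sum>i\<le>k. \<Sum>j\<le>?n. (-1) ^ j * int ((?n - i) choose j))"
        by (rule sum.swap)
      also have "\<dots> = 0"
      proof (rule sum.neutral, rule ballI)
        fix i assume "i \<in> {..k}"
        then show "(\<Sum>j\<le>?n. (-1) ^ j * int ((?n - i) choose j)) = 0"
          using sum_alternating_choose[of "?n - i" ?n] n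
          by (simp add: atMost_atLeast0 sum.atLeast_Suc_atMost)
      qed
      finally have "(\<Sum>j = 1..?n. (-1) ^ j * ?g j) = -1"
        using diag by (simp add: atMost_atLeast0 sum.atLeast_Suc_atMost[of 0])
      moreover have "euler_chi ?X (lam_le ?n k) (lam_rk ?n) (Face {}) Top
          = (\<Sum>j = 1..?n. (-1) ^ (j - 1) * ((if j = ?n then 1 else 0) + ?g j))"
        unfolding euler_chi_eq by (intro sum.cong) (auto simp: num)
      moreover have "\<dots> = (\<Sum>j = 1..?n. (if j = ?n then (-1) ^ m else 0) - (-1) ^ j * ?g j)"
        by (intro sum.cong) (auto simp: power_eq_if algebra_simps)
      ultimately show ?thesis
        by (simp only: sum_subtractf sum.delta finite_atLeastAtMost) (simp add: chi_sphere_def)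
    qed
    have "(\<Sum>i\<le>k. int (i choose ?n)) = 0" using n by (intro sum.neutral) auto
    then show "int (rank_num ?n) + chi_sphere ?n - euler_chi ?X (lam_le ?n k) (lam_rk ?n) (Face {}) Top
        = (\<Sum>i\<le>k. 1 * (1 + int ((?n - i) choose ?n) - int (i choose ?n)))"
      using diag num[of ?n] by (simp add: chi sum.distrib sum_subtractf)
  qed
  ultimately show ?thesis by simp
qed

section \<open>Evaluation of the cd-indices and conclusion\<close>

lemma Phi_Lambda_eval:
  assumes "k \<le> m"
  shows "finite {w. Phi_Lambda (Suc m) k w \<noteq> 0}"
    and "cd_eval (Phi_Lambda (Suc m) k) = (\<lambda>v. \<Sum>i\<le>k. check_poly m i v)"
proof -
  have "(\<lambda>v. \<Sum>i\<le>k. 1 * check_poly m i v) \<in> cd_image"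
    using assms by (intro cd_image_sum check_poly_in_cd_image) auto
  then have "chi'_sub (lam_carrier (Suc m) k) (lam_le (Suc m) k) (lam_rk (Suc m)) (Face {}) Top \<in> cd_image"
    using lam_chi'_sub[OF assms] by simp
  from cd_index_in_cd_image[OF this]
  show "finite {w. Phi_Lambda (Suc m) k w \<noteq> 0}"
    and "cd_eval (Phi_Lambda (Suc m) k) = (\<lambda>v. \<Sum>i\<le>k. check_poly m i v)"
    by (simp_all only: Phi_Lambda_def lam_chi'_sub[OF assms])
qed

text \<open>The polynomials of consecutive semisuspensions are partial sums that differ by one
  \<open>check_poly\<close>, so the defining difference telescopes.\<close>

lemma check_Phi_eval:
  assumes "i \<le> m"
  shows "finite {w. check_Phi (Suc m) i w \<noteq> 0}" and "cd_eval (check_Phi (Suc m) i) = check_poly m i"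
proof -
  have "finite {w. check_Phi (Suc m) i w \<noteq> 0} \<and> cd_eval (check_Phi (Suc m) i) = check_poly m i"
  proof (cases i)
    case 0
    then have "check_Phi (Suc m) i = Phi_Lambda (Suc m) 0" by (simp add: check_Phi_def)
    then show ?thesis using Phi_Lambda_eval[of 0 m] 0 by simp
  next
    case (Suc j)
    let ?\<Phi> = "Phi_Lambda (Suc m) i" and ?\<Phi>' = "Phi_Lambda (Suc m) j"
    have j: "j \<le> m" using assms Suc by simp
    have "check_Phi (Suc m) i = (\<lambda>w. ?\<Phi> w + (-1) * ?\<Phi>' w)"
      using assms Suc by (simp add: check_Phi_def fun_eq_iff)
    then show ?thesis
      using cd_eval_lin[OF Phi_Lambda_eval(1)[OF assms] Phi_Lambda_eval(1)[OF j], of "-1"]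
      unfolding Phi_Lambda_eval(2)[OF assms] Phi_Lambda_eval(2)[OF j] by (simp add: Suc)
  qed
  then show "finite {w. check_Phi (Suc m) i w \<noteq> 0}" "cd_eval (check_Phi (Suc m) i) = check_poly m i"
    by blast+
qed

theorem theorem3p6:
  fixes X :: "'a set" and le :: "'a \<Rightarrow> 'a \<Rightarrow> bool" and rk :: "'a \<Rightarrow> nat"
    and z0 z1 :: 'a and n :: nat
  assumes "graded_poset X le rk z0 z1"
    and "rk z1 = n + 1"
    and "n \<ge> 1"
    and "semi_eulerian X le rk z0 z1"
    and "simplicial_poset X le rk z0 z1"
  shows "cd_index X le rk z0 z1 =
           (\<lambda>w. \<Sum>i = 0..n - 1. h_vec X le rk z0 z1 i * check_Phi n i w)"
proof -
  obtain m where n: "n = Suc m" using assms(3) by (cases n) auto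
  let ?\<Phi> = "\<lambda>w. \<Sum>i\<le>m. h_vec X le rk z0 z1 i * check_Phi (Suc m) i w"
  have "finite {w. ?\<Phi> w \<noteq> 0} \<and> cd_eval ?\<Phi>
      = (\<lambda>v. \<Sum>i\<le>m. h_vec X le rk z0 z1 i * cd_eval (check_Phi (Suc m) i) v)"
    by (rule cd_eval_sum) (auto simp: check_Phi_eval)
  moreover have "(\<lambda>v. \<Sum>i\<le>m. h_vec X le rk z0 z1 i * cd_eval (check_Phi (Suc m) i) v)
      = chi'_sub X le rk z0 z1"
    using assms n by (subst simplicial_chi'_sub) (auto simp: check_Phi_eval(2))
  \<comment> \<open>The candidate has finite support and the right value, so uniqueness of the
    cd-index identifies it.\<close>
  ultimately have "cd_index X le rk z0 z1 = ?\<Phi>"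
    by (intro cd_index_eqI) auto
  then show ?thesis by (simp add: n atMost_atLeast0)
qed

end
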